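(* Let $(R,\mathfrak{m},k)$ be a commutative Noetherian local ring which is Artinian and satisfies $\mathfrak{m}^4=0$. If $\operatorname{ld}_R(k)<\infty$, then $\operatorname{ld}_R(k)=0$.
   Context: Let $(R,\mathfrak{m},k)$ be a commutative Noetherian local ring. Let $R^{\mathsf g}=\bigoplus_{i\ge0}\mathfrak{m}^i/\mathfrak{m}^{i+1}$ be the associated graded ring. For a minimal complex $\mathbf{F}:\cdots\to F_n\xrightarrow{\partial_n}F_{n-1}\to\cdots\to F_0\to 0$ of finitely generated free $R$-modules (minimal means $\partial_i(F_i)\subseteq\mathfrak{m}F_{i-1}$ for all $i$), consider the filtration $\mathfrak{F}^p\mathbf{F}$ with $(\mathfrak{F}^p\mathbf{F})_i=\mathfrak{m}^{p-i}F_i$ (with $\mathfrak{m}^j=R$ for $j\le 0$). The associated graded complex with respect to this filtration is the linear part $\operatorname{lin}^R(\mathbf{F})$; it is a complex of graded free $R^{\mathsf g}$-modules with $\operatorname{lin}^R_n(\mathbf{F})=F_n^{\mathsf g}(-n)$, where $F_n^{\mathsf g}=\bigoplus_{i\ge0}\mathfrak{m}^iF_n/\mathfrak{m}^{i+1}F_n$; its differential sends the class of $x\in\mathfrak{m}^iF_n$ in $\mathfrak{m}^iF_n/\mathfrak{m}^{i+1}F_n$ to the class of $\partial(x)$ in $\mathfrak{m}^{i+1}F_{n-1}/\mathfrak{m}^{i+2}F_{n-1}$. For a finitely generated $R$-module $M$ with minimal free resolution $\mathbf{F}$, the linearity defect is $\operatorname{ld}_R(M)=\sup\{i\in\mathbb{Z}: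 \operatorname{H}_i(\operatorname{lin}^R(\mathbf{F}))\neq 0\}$ (possibly infinite). *)

theory Defs
  imports "HOL-Algebra.Ideal_Product" "HOL-Algebra.Ring_Divisibility" "HOL-Library.Extended_Real"
begin

primrec ideal_pow :: "('a, 'b) ring_scheme \<Rightarrow> 'a set \<Rightarrow> nat \<Rightarrow> 'a set" where
  "ideal_pow R m 0 = carrier R"
| "ideal_pow R m (Suc i) = ideal_prod R m (ideal_pow R m i)"

definition artinian_ring :: "('a, 'b) ring_scheme \<Rightarrow> bool" where
  "artinian_ring R \<longleftrightarrow> (\<forall>I :: nat \<Rightarrow> 'a set.
      (\<forall>n. ideal (I n) R) \<and> (\<forall>n. I (Suc n) \<subseteq> I n) \<longrightarrow> (\<exists>N. \<forall>n\<ge>N. I n = I N))"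

definition noeth_local_ring :: "('a, 'b) ring_scheme \<Rightarrow> 'a set \<Rightarrow> bool" where
  "noeth_local_ring R m \<longleftrightarrow> cring R \<and> noetherian_ring R \<and> maximalideal m R
      \<and> (\<forall>J. maximalideal J R \<longrightarrow> J = m)"

definition fvecs :: "('a, 'b) ring_scheme \<Rightarrow> nat \<Rightarrow> (nat \<Rightarrow> 'a) set" where
  "fvecs R b = {x. (\<forall>k<b. x k \<in> carrier R) \<and> (\<forall>k\<ge>b. x k = \<zero>\<^bsub>R\<^esub>)}"

definition vzero :: "('a, 'b) ring_scheme \<Rightarrow> nat \<Rightarrow> 'a" where
  "vzero R = (\<lambda>_. \<zero>\<^bsub>R\<^esub>)"

definition vadd :: "('a, 'b) ring_scheme \<Rightarrow> (nat \<Rightarrow> 'a) \<Rightarrow> (nat \<Rightarrow> 'a) \<Rightarrow> nat \<Rightarrow> 'a" where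
  "vadd R x y = (\<lambda>j. x j \<oplus>\<^bsub>R\<^esub> y j)"

(* The differential  F_n = R^(b n) --> F_(n-1) = R^(b (n-1)),  given by the matrix d n *)
definition dmap :: "('a, 'b) ring_scheme \<Rightarrow> (nat \<Rightarrow> nat) \<Rightarrow> (nat \<Rightarrow> nat \<Rightarrow> nat \<Rightarrow> 'a)
    \<Rightarrow> nat \<Rightarrow> (nat \<Rightarrow> 'a) \<Rightarrow> nat \<Rightarrow> 'a" where
  "dmap R b d n x = (\<lambda>j. if j < b (n - 1)
      then finsum R (\<lambda>k. d n j k \<otimes>\<^bsub>R\<^esub> x k) {..<b n} else \<zero>\<^bsub>R\<^esub>)"

(* m^i F_n  (coordinatewise, F_n being free) *)
definition mF :: "('a, 'b) ring_scheme \<Rightarrow> 'a set \<Rightarrow> (nat \<Rightarrow> nat) \<Rightarrow> nat \<Rightarrow> nat \<Rightarrow> (nat \<Rightarrow> 'a) set" where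
  "mF R m b i n = {x \<in> fvecs R (b n). \<forall>k<b n. x k \<in> ideal_pow R m i}"

(* (b, d) is a minimal free resolution of the residue field k = R/m:
   ... --> R^(b 2) --d 2--> R^(b 1) --d 1--> R^(b 0) = R --> k --> 0,
   the augmentation R --> R/m being the canonical projection. *)
definition min_free_res_residue ::
    "('a, 'b) ring_scheme \<Rightarrow> 'a set \<Rightarrow> (nat \<Rightarrow> nat) \<Rightarrow> (nat \<Rightarrow> nat \<Rightarrow> nat \<Rightarrow> 'a) \<Rightarrow> bool" where
  "min_free_res_residue R m b d \<longleftrightarrow>
     (\<forall>n\<ge>1. \<forall>j k. j < b (n - 1) \<longrightarrow> k < b n \<longrightarrow> d n j k \<in> m)
   \<and> b 0 = 1
   \<and> dmap R b d 1 ` fvecs R (b 1) = {x \<in> fvecs R 1. x 0 \<in> m}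
   \<and> (\<forall>n\<ge>1. {x \<in> fvecs R (b n). dmap R b d n x = vzero R}
              = dmap R b d (Suc n) ` fvecs R (b (Suc n)))"

(* Linear part lin(F): its component of homological degree n and internal degree n+i is
   m^i F_n / m^(i+1) F_n, with differential induced by d.  The sets below are the
   representatives (in m^i F_n) of cycles and of boundaries of that component. *)
definition lin_cycles :: "('a, 'b) ring_scheme \<Rightarrow> 'a set \<Rightarrow> (nat \<Rightarrow> nat) \<Rightarrow> (nat \<Rightarrow> nat \<Rightarrow> nat \<Rightarrow> 'a)
    \<Rightarrow> nat \<Rightarrow> nat \<Rightarrow> (nat \<Rightarrow> 'a) set" where
  "lin_cycles R m b d n i =
     {x \<in> mF R m b i n. n = 0 \<or> dmap R b d n x \<in> mF R m b (i + 2) (n - 1)}"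

definition lin_boundaries :: "('a, 'b) ring_scheme \<Rightarrow> 'a set \<Rightarrow> (nat \<Rightarrow> nat) \<Rightarrow> (nat \<Rightarrow> nat \<Rightarrow> nat \<Rightarrow> 'a)
    \<Rightarrow> nat \<Rightarrow> nat \<Rightarrow> (nat \<Rightarrow> 'a) set" where
  "lin_boundaries R m b d n i =
     (if i = 0 then mF R m b 1 n
      else {vadd R (dmap R b d (Suc n) y) z | y z.
              y \<in> mF R m b (i - 1) (Suc n) \<and> z \<in> mF R m b (i + 1) n})"

definition lin_homology_nonzero :: "('a, 'b) ring_scheme \<Rightarrow> 'a set \<Rightarrow> (nat \<Rightarrow> nat)
    \<Rightarrow> (nat \<Rightarrow> nat \<Rightarrow> nat \<Rightarrow> 'a) \<Rightarrow> nat \<Rightarrow> bool" where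
  "lin_homology_nonzero R m b d n \<longleftrightarrow>
     (\<exists>i. \<not> lin_cycles R m b d n i \<subseteq> lin_boundaries R m b d n i)"

(* linearity defect computed from the resolution (b, d); sup of empty set = -\<infinity> *)
definition lin_defect :: "('a, 'b) ring_scheme \<Rightarrow> 'a set \<Rightarrow> (nat \<Rightarrow> nat)
    \<Rightarrow> (nat \<Rightarrow> nat \<Rightarrow> nat \<Rightarrow> 'a) \<Rightarrow> ereal" where
  "lin_defect R m b d = Sup {ereal (real n) | n. lin_homology_nonzero R m b d n}"

end

theory Submission
  imports Defs "HOL-Library.Function_Algebras"
begin

text \<open>Write \<open>F\<close> for the minimal resolution and suppose its linear part is exact in large degrees.

  A product \<open>F \<otimes> F \<rightarrow> F\<close> lifting \<open>R \<otimes> R = R\<close> exists, and every chain map \<open>\<psi>\<close> of \<open>F\<close> of negative degree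
  satisfies, modulo \<open>m\<close>, a coproduct formula
  \<open>\<psi>(w u) = w \<psi>(u) + \<Sum> \<plusminus> \<chi>\<^sub>v(w) \<psi>\<^sub>v(u)\<close>, where \<open>v\<close> runs over basis elements of positive degree: two chain
  maps \<open>F \<otimes> F \<rightarrow> F\<close> that agree modulo \<open>m\<close> in target degree 0 differ by a null-homotopic map.
  This formula replaces the Hopf algebra structure of \<open>Ext(k, k)\<close>.

  First, \<open>m\<^sup>3 F\<^sub>n = \<partial>(m\<^sup>2 F\<^sub>n\<^sub>+\<^sub>1)\<close> descends from large \<open>n\<close> to all \<open>n\<close>. If it holds above \<open>n\<close>, then the
  submodule \<open>W\<close> of those \<open>y\<close> in \<open>F\<^sub>n\<close> with \<open>m\<^sup>3 y \<subseteq> \<partial>(m\<^sup>2 F\<^sub>n\<^sub>+\<^sub>1)\<close> contains the image of every chain map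
  of negative degree, and the coproduct formula gives \<open>w \<psi>(u) \<in> W\<close> by induction on the degree of \<open>w\<close>, as
  long as that degree is smaller than the amount by which \<open>\<psi>\<close> lowers degrees. For \<open>w\<close> of degree \<open>n\<close> and
  \<open>\<psi>\<close> sending a basis element \<open>u\<close> of \<open>F\<^sub>n\<^sub>+\<^sub>1\<close> to 1 this says \<open>w \<in> W\<close>.

  Secondly, let \<open>K\<^sub>n\<close> be the set of \<open>x\<close> in \<open>F\<^sub>n\<close> with \<open>\<partial>x \<in> m\<^sup>2 F\<^sub>n\<^sub>-\<^sub>1\<close>, and suppose \<open>K\<^sub>n \<subseteq> m F\<^sub>n\<close> fails for
  some positive \<open>n\<close>, for the last time at \<open>t\<close> and for the first time at \<open>c\<close>. Take \<open>w\<close> in \<open>K\<^sub>t\<close>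
  and \<open>x\<close> in \<open>K\<^sub>c\<close> outside \<open>m F\<close>, and a chain map \<open>f\<close> with \<open>f(w) = 1\<close> modulo \<open>m\<close>. The cycle
  \<open>\<partial>x w\<close> lies in \<open>\<partial>(m F\<^sub>c\<^sub>+\<^sub>t)\<close> because \<open>c + t > t\<close>, while \<open>f(\<partial>x w)\<close> is \<open>\<partial>x\<close> modulo \<open>m\<^sup>3 F\<close> because
  \<open>K\<^sub>a \<subseteq> m F\<^sub>a\<close> for \<open>0 < a < c\<close>. Hence \<open>\<partial>x \<in> \<partial>(m F\<^sub>c)\<close> and so \<open>x \<in> m F\<^sub>c\<close>, a contradiction.
  The remaining exactness is a diagram chase using \<open>m\<^sup>4 = 0\<close>.\<close>

section \<open>Vectors over a filtered ring\<close>

definition vscale :: "'r::comm_ring \<Rightarrow> ('i \<Rightarrow> 'r) \<Rightarrow> 'i \<Rightarrow> 'r" where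
  "vscale r x = (\<lambda>i. r * x i)"

definition sg :: "nat \<Rightarrow> 'v::ab_group_add \<Rightarrow> 'v" where
  "sg n x = (if even n then x else - x)"

definition lin :: "(('i \<Rightarrow> 'r::comm_ring) \<Rightarrow> 'j \<Rightarrow> 'r) \<Rightarrow> bool" where
  "lin f \<longleftrightarrow> (\<forall>x y. f (x + y) = f x + f y) \<and> (\<forall>r x. f (vscale r x) = vscale r (f x))"

lemma sum_fun_apply: "(\<Sum>a\<in>A. f a) i = (\<Sum>a\<in>A. f a i)"
  by (induction A rule: infinite_finite_induct) auto

lemma vscale_simps:
  "vscale r (x + y) = vscale r x + vscale r y"
  "vscale r (x - y) = vscale r x - vscale r y"
  "vscale r (- x) = - vscale r x"
  "vscale r 0 = 0" "vscale 0 x = 0"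
  "vscale (r + s) x = vscale r x + vscale s x"
  "vscale r (vscale s x) = vscale (r * s) x"
  "vscale r (\<Sum>a\<in>A. f a) = (\<Sum>a\<in>A. vscale r (f a))"
  by (auto simp: vscale_def fun_eq_iff algebra_simps sum_fun_apply sum_distrib_left)

lemma linD:
  assumes "lin f"
  shows "f (x + y) = f x + f y" "f (vscale r x) = vscale r (f x)" "f 0 = 0"
    "f (- x) = - f x" "f (x - y) = f x - f y" "f (\<Sum>a\<in>A. h a) = (\<Sum>a\<in>A. f (h a))"
    "f (sg n x) = sg n (f x)"
proof -
  show add: "f (x + y) = f x + f y" for x y using assms by (auto simp: lin_def)
  show "f (vscale r x) = vscale r (f x)" using assms by (auto simp: lin_def)
  show z: "f 0 = 0" using add[of 0 0] by simp
  show neg: "f (- x) = - f x" for x using add[of x "- x"] z by (simp add: eq_neg_iff_add_eq_0 add.commute)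
  show "f (x - y) = f x - f y" using add[of x "- y"] neg[of y] by simp
  show "f (\<Sum>a\<in>A. h a) = (\<Sum>a\<in>A. f (h a))"
    using sum_comp_morphism[of f h A, OF z add] by (simp add: o_def)
  show "f (sg n x) = sg n (f x)" by (simp add: sg_def neg)
qed

lemma sg_simps:
  "sg n (x + y) = sg n x + sg n y" "sg n (x - y) = sg n x - sg n y"
  "sg n (0) = 0" "sg n (sg m x) = sg (n + m) x" "sg 0 x = x" "sg n (- x) = - sg n x"
  "sg n (\<Sum>a\<in>A. f a) = (\<Sum>a\<in>A. sg n (f a))"
  by (auto simp: sg_def sum_negf)

lemma sg_vscale: "sg n (vscale r x) = vscale r (sg n x)"
  by (simp add: sg_def vscale_simps)

lemma lin_zero: "lin (\<lambda>_. 0)" "lin 0"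
  by (auto simp: lin_def vscale_simps)

lemma lin_id: "lin (\<lambda>x. x)"
  by (auto simp: lin_def)

lemma lin_comp: "lin f \<Longrightarrow> lin g \<Longrightarrow> lin (\<lambda>x. f (g x))"
  by (auto simp: lin_def)

lemma lin_diff: "lin f \<Longrightarrow> lin g \<Longrightarrow> lin (\<lambda>x. f x - g x)"
  by (auto simp: lin_def vscale_simps)

lemma lin_add: "lin f \<Longrightarrow> lin g \<Longrightarrow> lin (\<lambda>x. f x + g x)"
  by (auto simp: lin_def vscale_simps)

lemma lin_sg: "lin f \<Longrightarrow> lin (\<lambda>x. sg n (f x))"
  by (auto simp: lin_def sg_simps sg_vscale)

lemma lin_sum: "(\<And>a. a \<in> A \<Longrightarrow> lin (f a)) \<Longrightarrow> lin (\<lambda>x. \<Sum>a\<in>A. f a x)"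
  by (simp add: lin_def sum.distrib vscale_simps)

text \<open>The ring of interest is \<open>I 0\<close>, with unit \<open>e\<close>; \<open>I k\<close> stands for the \<open>k\<close>-th power of its maximal ideal.\<close>

locale filtered_ring =
  fixes e :: "'r::comm_ring" and I :: "nat \<Rightarrow> 'r set"
  assumes I_0: "I 0 = {r. e * r = r}"
    and I_zero: "0 \<in> I k"
    and I_add: "x \<in> I k \<Longrightarrow> y \<in> I k \<Longrightarrow> x + y \<in> I k"
    and I_scale: "y \<in> I k \<Longrightarrow> r * y \<in> I k"
    and I_Suc: "I (Suc k) \<subseteq> I k"
    and I_mult: "x \<in> I k \<Longrightarrow> y \<in> I l \<Longrightarrow> x * y \<in> I (k + l)"
    and I_4: "I 4 = {0}"
    and e_idem: "e * e = e"
    and I_max: "r \<in> I 0 \<Longrightarrow> r \<notin> I 1 \<Longrightarrow> \<exists>s. s * r - e \<in> I 1"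
begin

lemma I_mono: "l \<le> k \<Longrightarrow> I k \<subseteq> I l"
  by (induction rule: inc_induct) (use I_Suc in blast)+

lemma I_e: "x \<in> I k \<Longrightarrow> e * x = x"
  using I_mono[of 0 k] I_0 by auto

lemma I_minus: "x \<in> I k \<Longrightarrow> - x \<in> I k"
  using I_scale[of x k "- e"] I_e[of x k] by simp

text \<open>\<open>M k B\<close> is \<open>m\<^sup>k\<close> times the free module on \<open>B\<close>.\<close>

definition M :: "nat \<Rightarrow> 'i set \<Rightarrow> ('i \<Rightarrow> 'r) set" where
  "M k B = {x. (\<forall>i. i \<notin> B \<longrightarrow> x i = 0) \<and> (\<forall>i. x i \<in> I k)}"

lemma M_mono: "l \<le> k \<Longrightarrow> x \<in> M k B \<Longrightarrow> x \<in> M l B"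
  using I_mono[of l k] by (auto simp: M_def)

lemma M_zero [simp]: "0 \<in> M k B"
  using I_zero by (auto simp: M_def)

lemma M_add: "x \<in> M k B \<Longrightarrow> y \<in> M k B \<Longrightarrow> x + y \<in> M k B"
  by (auto simp: M_def I_add)

lemma M_minus: "x \<in> M k B \<Longrightarrow> - x \<in> M k B"
  by (auto simp: M_def I_minus)

lemma M_diff: "x \<in> M k B \<Longrightarrow> y \<in> M k B \<Longrightarrow> x - y \<in> M k B"
  using M_add[of x k B "- y"] M_minus[of y k B] by simp

lemma M_sg: "x \<in> M k B \<Longrightarrow> sg n x \<in> M k B"
  by (simp add: sg_def M_minus)

lemma M_scale: "x \<in> M k B \<Longrightarrow> vscale r x \<in> M k B"
  by (auto simp: M_def vscale_def I_scale)

lemma M_scale_I: "r \<in> I k \<Longrightarrow> x \<in> M l B \<Longrightarrow> vscale r x \<in> M (k + l) B"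
  by (auto simp: M_def vscale_def I_mult)

lemma M_sum: "(\<And>a. a \<in> A \<Longrightarrow> f a \<in> M k B) \<Longrightarrow> (\<Sum>a\<in>A. f a) \<in> M k B"
  by (induction A rule: infinite_finite_induct) (auto simp: M_add)

lemma M_4: "4 \<le> k \<Longrightarrow> x \<in> M k B \<Longrightarrow> x = 0"
  using M_mono[of 4 k x B] I_4 by (auto simp: M_def fun_eq_iff)

lemma M_e: "x \<in> M k B \<Longrightarrow> vscale e x = x"
  by (auto simp: M_def vscale_def fun_eq_iff intro: I_e)

lemma M_empty: "x \<in> M k {} \<longleftrightarrow> x = 0"
  using I_zero by (auto simp: M_def fun_eq_iff)

definition E :: "'i \<Rightarrow> 'i \<Rightarrow> 'r" where
  "E i = (\<lambda>j. if j = i then e else 0)"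

lemma E_in: "i \<in> B \<Longrightarrow> E i \<in> M 0 B"
  using I_zero by (auto simp: M_def E_def I_0 e_idem)

lemma E_scale_in: "i \<in> B \<Longrightarrow> r \<in> I k \<Longrightarrow> vscale r (E i) \<in> M k B"
  using M_scale_I[OF _ E_in, of r k i B] by simp

lemma M_expand:
  assumes "finite B" "x \<in> M k B"
  shows "x = (\<Sum>i\<in>B. vscale (x i) (E i))"
proof
  fix j
  have "(\<Sum>i\<in>B. vscale (x i) (E i)) j = (\<Sum>i\<in>B. if j = i then x j * e else 0)"
    by (auto simp: sum_fun_apply vscale_def E_def intro: sum.cong)
  also have "\<dots> = x j"
    using assms I_e[of "x j" k] by (auto simp: M_def mult.commute)
  finally show "x j = (\<Sum>i\<in>B. vscale (x i) (E i)) j" by simp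
qed

definition ext :: "'i set \<Rightarrow> ('i \<Rightarrow> 'j \<Rightarrow> 'r) \<Rightarrow> ('i \<Rightarrow> 'r) \<Rightarrow> 'j \<Rightarrow> 'r" where
  "ext B c x = (\<Sum>i\<in>B. vscale (x i) (c i))"

lemma lin_ext: "lin (ext B c)"
  by (auto simp: lin_def ext_def vscale_simps sum.distrib vscale_def[of _ x for x]
      fun_eq_iff sum_fun_apply sum_distrib_left algebra_simps)

lemma ext_E:
  assumes "finite B" "i \<in> B" "c i \<in> M k C"
  shows "ext B c (E i) = c i"
proof -
  have "ext B c (E i) = (\<Sum>j\<in>B. if j = i then c i else 0)"
    unfolding ext_def using M_e[OF assms(3)] by (auto simp: E_def vscale_simps intro!: sum.cong)
  then show ?thesis using assms by simp
qed

lemma lin_expand: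
  assumes "lin f" "finite B" "x \<in> M k B"
  shows "f x = (\<Sum>i\<in>B. vscale (x i) (f (E i)))"
  using arg_cong[OF M_expand[OF assms(2,3)], of f] by (simp add: linD[OF assms(1)])

text \<open>The coefficients of \<open>x\<close> contribute \<open>k\<close> and the values on the
  basis contribute \<open>l\<close>. Later this turns a congruence modulo \<open>m\<close> into one
  modulo \<open>m^3\<close> for arguments in \<open>m^2 F\<close>.\<close>

lemma lin_M:
  assumes "lin f" "finite B" "\<And>i. i \<in> B \<Longrightarrow> f (E i) \<in> M l C" "x \<in> M k B"
  shows "f x \<in> M (k + l) C"
  unfolding lin_expand[OF assms(1,2,4)]
  using assms(4) by (intro M_sum M_scale_I assms(3)) (auto simp: M_def)

lemma ext_M:
  assumes "finite B" "\<And>i. i \<in> B \<Longrightarrow> c i \<in> M l C" "x \<in> M k B"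
  shows "ext B c x \<in> M (k + l) C"
  using assms by (intro lin_M[OF lin_ext]) (auto simp: ext_E[OF assms(1) _ assms(2)])

lemma lin_M':
  assumes "lin f" "finite B" "\<And>y. y \<in> M 0 B \<Longrightarrow> f y \<in> M l C" "x \<in> M k B"
  shows "f x \<in> M (k + l) C"
  using assms by (intro lin_M[OF assms(1,2)]) (auto simp: E_in)

lemma lin_eq:
  assumes "lin f" "lin g" "finite B" "\<And>i. i \<in> B \<Longrightarrow> f (E i) = g (E i)" "x \<in> M k B"
  shows "f x = g x"
  using lin_expand[OF assms(1,3,5)] lin_expand[OF assms(2,3,5)] assms(4) by simp

text \<open>Free modules are projective: preimages of the basis vectors are chosen and extended
  linearly.\<close>

lemma free_lift:
  assumes A: "finite A" and D: "lin D" and f: "lin f"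
    and ex: "\<And>i. i \<in> A \<Longrightarrow> \<exists>y \<in> M 0 B. D y = f (E i)"
  shows "\<exists>h. lin h \<and> (\<forall>x \<in> M 0 A. h x \<in> M 0 B \<and> D (h x) = f x)"
proof -
  have "\<forall>i\<in>A. \<exists>y. y \<in> M 0 B \<and> D y = f (E i)" using ex by blast
  from bchoice[OF this] obtain y where
    y: "\<And>i. i \<in> A \<Longrightarrow> y i \<in> M 0 B" "\<And>i. i \<in> A \<Longrightarrow> D (y i) = f (E i)" by blast
  have "D (ext A y (E i)) = f (E i)" if "i \<in> A" for i
    using ext_E[OF A that, of y, OF y(1)] y(2) that by simp
  then have "D (ext A y x) = f x" if "x \<in> M 0 A" for x
    using lin_eq[OF lin_comp[OF D lin_ext] f A _ that] by blast
  moreover have "ext A y x \<in> M 0 B" if "x \<in> M 0 A" for x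
    using ext_M[OF A y(1) that] by simp
  ultimately show ?thesis using lin_ext[of A y] by blast
qed

section \<open>Minimal complexes, resolutions and chain maps\<close>

definition cx :: "(nat \<Rightarrow> 'i set) \<Rightarrow> (nat \<Rightarrow> ('i \<Rightarrow> 'r) \<Rightarrow> 'i \<Rightarrow> 'r) \<Rightarrow> bool" where
  "cx B D \<longleftrightarrow> (\<forall>n. finite (B n)) \<and> (\<forall>n. lin (D n)) \<and> D 0 = 0
     \<and> (\<forall>n x. x \<in> M 0 (B n) \<longrightarrow> D n x \<in> M 1 (B (n - 1)))
     \<and> (\<forall>n x. x \<in> M 0 (B n) \<longrightarrow> D (n - 1) (D n x) = 0)"

text \<open>Exactness in positive degrees; in degree 0, together with minimality, the image of
  \<open>D 1\<close> is \<open>M 1 (B 0)\<close>. For a one-element \<open>B 0\<close> this is a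
  minimal resolution of the residue field.\<close>

definition res :: "(nat \<Rightarrow> 'i set) \<Rightarrow> (nat \<Rightarrow> ('i \<Rightarrow> 'r) \<Rightarrow> 'i \<Rightarrow> 'r) \<Rightarrow> bool" where
  "res B D \<longleftrightarrow> cx B D \<and> (\<forall>n x. x \<in> M 0 (B n) \<longrightarrow> D n x = 0 \<longrightarrow> (n = 0 \<longrightarrow> x \<in> M 1 (B 0)) \<longrightarrow>
     (\<exists>y \<in> M 0 (B (Suc n)). D (Suc n) y = x))"

text \<open>A chain map of degree \<open>-t\<close>, strictly commuting with the differentials. Target degrees are truncated
  differences, which is harmless because the map vanishes in source degrees below \<open>t\<close>.\<close>

definition cm :: "(nat \<Rightarrow> 'i set) \<Rightarrow> (nat \<Rightarrow> ('i \<Rightarrow> 'r) \<Rightarrow> 'i \<Rightarrow> 'r)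
    \<Rightarrow> (nat \<Rightarrow> 'j set) \<Rightarrow> (nat \<Rightarrow> ('j \<Rightarrow> 'r) \<Rightarrow> 'j \<Rightarrow> 'r)
    \<Rightarrow> nat \<Rightarrow> (nat \<Rightarrow> ('i \<Rightarrow> 'r) \<Rightarrow> 'j \<Rightarrow> 'r) \<Rightarrow> bool" where
  "cm A P B D t g \<longleftrightarrow> (\<forall>n. lin (g n)) \<and> (\<forall>n<t. g n = 0)
     \<and> (\<forall>n x. x \<in> M 0 (A n) \<longrightarrow> g n x \<in> M 0 (B (n - t)))
     \<and> (\<forall>n x. x \<in> M 0 (A n) \<longrightarrow> D (n - t) (g n x) = g (n - 1) (P n x))"

lemma cxD:
  assumes "cx B D"
  shows "finite (B n)" "lin (D n)" "D 0 = 0" "x \<in> M 0 (B n) \<Longrightarrow> D n x \<in> M 1 (B (n - 1))"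
    "x \<in> M 0 (B n) \<Longrightarrow> D (n - 1) (D n x) = 0"
  using assms unfolding cx_def by blast+

lemma cx_M:
  assumes D: "cx B D" and x: "x \<in> M k (B n)"
  shows "D n x \<in> M (Suc k) (B (n - 1))"
  using lin_M'[OF cxD(2)[OF D] cxD(1)[OF D] cxD(4)[OF D] x] by simp

lemma resD:
  assumes "res B D"
  shows "cx B D"
    "x \<in> M 0 (B n) \<Longrightarrow> D n x = 0 \<Longrightarrow> (n = 0 \<Longrightarrow> x \<in> M 1 (B 0)) \<Longrightarrow> \<exists>y \<in> M 0 (B (Suc n)). D (Suc n) y = x"
  using assms unfolding res_def by blast+

lemma cmD:
  assumes "cm A P B D t g"
  shows "lin (g n)" "n < t \<Longrightarrow> g n = 0" "x \<in> M 0 (A n) \<Longrightarrow> g n x \<in> M 0 (B (n - t))"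
    "x \<in> M 0 (A n) \<Longrightarrow> D (n - t) (g n x) = g (n - 1) (P n x)"
  using assms unfolding cm_def by blast+

lemma cm_M:
  assumes "cm A P B D t g" "cx A P" "x \<in> M k (A n)" shows "g n x \<in> M k (B (n - t))"
  using lin_M'[OF cmD(1)[OF assms(1)] cxD(1)[OF assms(2)] cmD(3)[OF assms(1)] assms(3)] by simp

lemma cm_comp:
  assumes g: "cm A P B D t g" and f: "cm B D C Q s f"
  shows "cm A P C Q (t + s) (\<lambda>n x. f (n - t) (g n x))"
  unfolding cm_def
proof (intro conjI allI impI)
  show "lin (\<lambda>x. f (n - t) (g n x))" for n
    using cmD(1)[OF g] cmD(1)[OF f] by (rule lin_comp[rotated])
  show "(\<lambda>x. f (n - t) (g n x)) = 0" if "n < t + s" for n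
  proof (cases "n < t")
    case True
    have "f (n - t) (g n x) = 0" for x
      unfolding cmD(2)[OF g True] by (simp add: linD(3)[OF cmD(1)[OF f]])
    then show ?thesis by (auto simp: fun_eq_iff)
  next
    case False
    then have "n - t < s" using that by auto
    from cmD(2)[OF f this] show ?thesis by auto
  qed
  fix n x assume x: "x \<in> M 0 (A n)"
  show "f (n - t) (g n x) \<in> M 0 (C (n - (t + s)))"
    using cmD(3)[OF f cmD(3)[OF g x]] by simp
  show "Q (n - (t + s)) (f (n - t) (g n x)) = f (n - 1 - t) (g (n - 1) (P n x))"
    using cmD(4)[OF f cmD(3)[OF g x]] cmD(4)[OF g x] by (simp add: diff_commute)
qed

lemma cm_diff:
  assumes g: "cm A P B D t g" and f: "cm A P B D t f" and D: "cx B D"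
  shows "cm A P B D t (\<lambda>n x. g n x - f n x)"
  using assms unfolding cm_def
  by (auto simp: lin_diff M_diff linD(5)[OF cxD(2)[OF D]] fun_eq_iff)

lemma cm_sum:
  assumes g: "\<And>a. a \<in> S \<Longrightarrow> cm A P B D t (g a)" and D: "cx B D"
  shows "cm A P B D t (\<lambda>n x. \<Sum>a\<in>S. g a n x)"
  unfolding cm_def
  using cmD[OF g] by (auto simp: lin_sum M_sum linD(6)[OF cxD(2)[OF D]] fun_eq_iff sum_fun_apply)

lemma cm_id: "cx B D \<Longrightarrow> cm B D B D 0 (\<lambda>n x. x)"
  by (auto simp: cm_def lin_id)

text \<open>The comparison theorem: components are built one target degree at a time through
  exactness of \<open>D\<close>. Minimality of \<open>P\<close> puts each lifting obstruction into
  \<open>m F\<close>, so it is a boundary even in degree 0.\<close>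

lemma lift:
  fixes A :: "nat \<Rightarrow> 'i set" and B :: "nat \<Rightarrow> 'j set"
  assumes P: "cx A P" and F: "res B D" and c: "\<And>i. i \<in> A t \<Longrightarrow> c i \<in> M 0 (B 0)"
  obtains g where "cm A P B D t g" "\<And>i. i \<in> A t \<Longrightarrow> g t (E i) = c i"
proof -
  note D = resD(1)[OF F]
  \<comment> \<open>Here \<open>n\<close> is the target degree and \<open>n + t\<close> the source
    degree. The third conjunct makes the next lifting problem solvable.\<close>
  define Pr where "Pr n h \<longleftrightarrow> lin h \<and> (\<forall>x \<in> M 0 (A (n + t)). h x \<in> M 0 (B n))
    \<and> (\<forall>x \<in> M 0 (A (Suc n + t)). D n (h (P (Suc n + t) x)) = 0 \<and> h (P (Suc n + t) x) \<in> M 1 (B n))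
    \<and> (n = 0 \<longrightarrow> h = ext (A t) c)" for n h
  define Q where "Q n h h' \<longleftrightarrow> (\<forall>x \<in> M 0 (A (Suc n + t)). D (Suc n) (h' x) = h (P (Suc n + t) x))"
    for n h h'
  have PM: "h (P (Suc n + t) x) \<in> M 1 (B n)"
    if "lin h" "\<forall>x \<in> M 0 (A (n + t)). h x \<in> M 0 (B n)" "x \<in> M 0 (A (Suc n + t))" for h n x
    using lin_M'[OF that(1) cxD(1)[OF P], of "n + t" 0 "B n" "P (Suc n + t) x" 1]
      that cxD(4)[OF P, of x "Suc n + t"] by auto
  have "\<exists>f. \<forall>n. Pr n (f n) \<and> Q n (f n) (f (Suc n))"
  proof (rule dependent_nat_choice)
    have "\<forall>x \<in> M 0 (A t). ext (A t) c x \<in> M 0 (B 0)"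
      using ext_M[OF cxD(1)[OF P] c, where k = 0] by simp
    moreover have "D 0 = 0" using cxD(3)[OF D] .
    ultimately have "Pr 0 (ext (A t) c)"
      unfolding Pr_def using PM[OF lin_ext, of 0 "A t" c] by (auto simp: lin_ext)
    then show "\<exists>h. Pr 0 h" by blast
  next
    fix n h assume h: "Pr n h"
    let ?A = "A (Suc n + t)"
    have lh: "lin h" using h by (simp add: Pr_def)
    have "\<exists>y \<in> M 0 (B (Suc n)). D (Suc n) y = h (P (Suc n + t) (E i))" if "i \<in> ?A" for i
    proof -
      have z: "D n (h (P (Suc n + t) (E i))) = 0" "h (P (Suc n + t) (E i)) \<in> M 1 (B n)"
        using h E_in[OF that] by (simp_all add: Pr_def)
      show ?thesis
        using resD(2)[OF F M_mono[OF _ z(2)] z(1)] z(2) by (cases n) auto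
    qed
    then obtain h' where lh': "lin h'" and hM: "\<And>x. x \<in> M 0 ?A \<Longrightarrow> h' x \<in> M 0 (B (Suc n))"
      and Dh: "\<And>x. x \<in> M 0 ?A \<Longrightarrow> D (Suc n) (h' x) = h (P (Suc n + t) x)"
      using free_lift[OF cxD(1)[OF P] cxD(2)[OF D] lin_comp[OF lh cxD(2)[OF P]]] by blast
    have DhP: "D (Suc n) (h' (P (Suc (Suc n) + t) x)) = 0" if x: "x \<in> M 0 (A (Suc (Suc n) + t))" for x
      using Dh[of "P (Suc (Suc n) + t) x"] cxD(4,5)[OF P x] h linD(3)[of h]
        M_mono[of 0 1 "P (Suc (Suc n) + t) x"] by (simp add: Pr_def)
    have "Pr (Suc n) h'" "Q n h h'"
      unfolding Pr_def Q_def using hM PM[OF lh', of "Suc n"] Dh DhP lh' by simp_all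
    then show "\<exists>h'. Pr (Suc n) h' \<and> Q n h h'" by blast
  qed
  then obtain f where f: "\<And>n. Pr n (f n)" "\<And>n. Q n (f n) (f (Suc n))" by blast
  define g where "g n = (if n < t then 0 else f (n - t))" for n
  have "cm A P B D t g"
    unfolding cm_def
  proof (intro conjI allI impI)
    show "lin (g n)" for n using f(1)[of "n - t"] by (auto simp: g_def Pr_def lin_zero)
    show "g n = 0" if "n < t" for n using that by (simp add: g_def)
    fix n x assume x: "x \<in> M 0 (A n)"
    show "g n x \<in> M 0 (B (n - t))" using f(1)[of "n - t"] x by (auto simp: g_def Pr_def)
    show "D (n - t) (g n x) = g (n - 1) (P n x)"
    \<comment> \<open>Both sides vanish up to degree \<open>t\<close>: \<open>g\<close> is 0 below
      \<open>t\<close>, at \<open>n = t\<close> the left side is 0 by \<open>D 0 = 0\<close>, and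
      for \<open>t = 0\<close> the right side is 0 by \<open>P 0 = 0\<close>.\<close>
    proof (cases "n \<le> t")
      case True
      then have "n < t \<or> n = t" by auto
      then show ?thesis using f(1)[of 0] cxD(3)[OF D] cxD(3)[OF P]
        by (cases n) (auto simp: g_def Pr_def linD(3))
    next
      case False
      define k where "k = n - Suc t"
      then have "n = Suc k + t" using False by simp
      then show ?thesis using f(2)[of k] x by (auto simp: g_def Q_def Suc_diff_le)
    qed
  qed
  moreover have "g t (E i) = c i" if "i \<in> A t" for i
    using f(1)[of 0] ext_E[where B = "A t" and c = c, OF cxD(1)[OF P] that c[OF that]]
    by (simp add: g_def Pr_def)
  ultimately show thesis by (rule that)
qed

text \<open>A chain map that is trivial modulo \<open>m\<close> in target degree 0 is null-homotopic.\<close>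

lemma cm_minimal:
  assumes P: "cx A P" and F: "res B D" and g: "cm A P B D t g"
    and c: "\<And>i. i \<in> A t \<Longrightarrow> g t (E i) \<in> M 1 (B 0)"
    and x: "x \<in> M 0 (A n)"
  shows "g n x \<in> M 1 (B (n - t))"
proof (cases "n < t")
  case True then show ?thesis using cmD(2)[OF g] by simp
next
  case False
  note D = resD(1)[OF F]
  \<comment> \<open>Only the last component \<open>h\<close> of the homotopy is carried along.
    Beyond degree 0, what \<open>D h\<close> misses of \<open>g\<close> is the preceding component
    applied to \<open>P x\<close>, and this lies in \<open>m F\<close> by minimality.\<close>
  have "\<exists>h. lin h \<and> (\<forall>x \<in> M 0 (A (n + t)). h x \<in> M 0 (B (Suc n)))
    \<and> (\<forall>x \<in> M 0 (A (Suc n + t)). D (Suc n) (g (Suc n + t) x - h (P (Suc n + t) x)) = 0)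
    \<and> (\<forall>x \<in> M 0 (A (n + t)). g (n + t) x - D (Suc n) (h x) \<in> M 1 (B n))" for n
  proof (induction n)
    case 0
    have "\<exists>y \<in> M 0 (B 1). D 1 y = g t (E i)" if "i \<in> A t" for i
      using resD(2)[OF F, of "g t (E i)" 0] c[OF that] M_mono[OF _ c[OF that], of 0] cxD(3)[OF D] by auto
    then obtain h where lh: "lin h" and hM: "\<And>x. x \<in> M 0 (A t) \<Longrightarrow> h x \<in> M 0 (B 1)"
      and Dh: "\<And>x. x \<in> M 0 (A t) \<Longrightarrow> D 1 (h x) = g t x"
      using free_lift[OF cxD(1)[OF P] cxD(2)[OF D] cmD(1)[OF g]] by blast
    have "D 1 (g (Suc t) x - h (P (Suc t) x)) = 0" if x: "x \<in> M 0 (A (Suc t))" for x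
      using cmD(4)[OF g x] Dh[of "P (Suc t) x"] cxD(4)[OF P x] M_mono[of 0 1 "P (Suc t) x"]
      by (simp add: linD[OF cxD(2)[OF D]])
    then have "\<forall>x \<in> M 0 (A (0 + t)). h x \<in> M 0 (B (Suc 0))"
      "\<forall>x \<in> M 0 (A (Suc 0 + t)). D (Suc 0) (g (Suc 0 + t) x - h (P (Suc 0 + t) x)) = 0"
      "\<forall>x \<in> M 0 (A (0 + t)). g (0 + t) x - D (Suc 0) (h x) \<in> M 1 (B 0)"
      using hM Dh by simp_all
    then show ?case using lh by blast
  next
    case (Suc n)
    then obtain h where h: "lin h" "\<And>x. x \<in> M 0 (A (n + t)) \<Longrightarrow> h x \<in> M 0 (B (Suc n))"
      "\<And>x. x \<in> M 0 (A (Suc n + t)) \<Longrightarrow> D (Suc n) (g (Suc n + t) x - h (P (Suc n + t) x)) = 0" by blast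
    let ?A = "A (Suc n + t)"
    let ?r = "\<lambda>x. g (Suc n + t) x - h (P (Suc n + t) x)"
    have PM: "P (Suc n + t) x \<in> M 1 (A (n + t))" if "x \<in> M 0 ?A" for x
      using cxD(4)[OF P that] by simp
    have hPM: "h (P (Suc n + t) x) \<in> M 1 (B (Suc n))" if "x \<in> M 0 ?A" for x
      using lin_M'[OF h(1) cxD(1)[OF P] h(2) PM[OF that]] by simp
    have rM: "?r x \<in> M 0 (B (Suc n))" if "x \<in> M 0 ?A" for x
      using cmD(3)[OF g that] M_mono[OF _ hPM[OF that], of 0] by (auto intro!: M_diff)
    have "\<exists>y \<in> M 0 (B (Suc (Suc n))). D (Suc (Suc n)) y = ?r (E i)" if "i \<in> ?A" for i
      using resD(2)[OF F, of "?r (E i)" "Suc n"] h(3)[OF E_in[OF that]] rM[OF E_in[OF that]] by blast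
    then obtain h' where lh': "lin h'" and hM: "\<And>x. x \<in> M 0 ?A \<Longrightarrow> h' x \<in> M 0 (B (Suc (Suc n)))"
      and Dh: "\<And>x. x \<in> M 0 ?A \<Longrightarrow> D (Suc (Suc n)) (h' x) = ?r x"
      using free_lift[OF cxD(1)[OF P] cxD(2)[OF D]
        lin_diff[OF cmD(1)[OF g] lin_comp[OF h(1) cxD(2)[OF P]]]] by blast
    have "D (Suc (Suc n)) (g (Suc (Suc n) + t) x - h' (P (Suc (Suc n) + t) x)) = 0"
      if x: "x \<in> M 0 (A (Suc (Suc n) + t))" for x
    proof -
      let ?x = "P (Suc (Suc n) + t) x"
      have Px: "?x \<in> M 0 ?A" using cxD(4)[OF P x] M_mono[of 0 1 ?x] by simp
      have "P (Suc n + t) ?x = 0" using cxD(5)[OF P x] by simp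
      then show ?thesis using cmD(4)[OF g x] Dh[OF Px] linD(3)[OF h(1)]
        by (simp add: linD(5)[OF cxD(2)[OF D]])
    qed
    moreover have "g (Suc n + t) x - D (Suc (Suc n)) (h' x) \<in> M 1 (B (Suc n))" if "x \<in> M 0 ?A" for x
      using hPM[OF that] Dh[OF that] by simp
    ultimately show ?case using hM lh' by blast
  qed
  from this[of "n - t"] False obtain h where
    h: "\<And>x. x \<in> M 0 (A n) \<Longrightarrow> h x \<in> M 0 (B (Suc (n - t)))"
       "\<And>x. x \<in> M 0 (A n) \<Longrightarrow> g n x - D (Suc (n - t)) (h x) \<in> M 1 (B (n - t))" by auto
  have "D (Suc (n - t)) (h x) \<in> M 1 (B (n - t))" using cxD(4)[OF D h(1)[OF x]] by simp
  from M_add[OF h(2)[OF x] this] show ?thesis by simp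
qed

end

section \<open>Products on a minimal resolution\<close>

locale resolution = filtered_ring e I
  for e :: "'r::comm_ring" and I :: "nat \<Rightarrow> 'r set" +
  fixes B :: "nat \<Rightarrow> 'i set" and D :: "nat \<Rightarrow> ('i \<Rightarrow> 'r) \<Rightarrow> 'i \<Rightarrow> 'r" and z :: 'i
  assumes res: "res B D" and B_0: "B 0 = {z}"
begin

lemmas cxB = resD(1)[OF res]
lemmas finB [simp] = cxD(1)[OF cxB]
lemmas linDiff = cxD(2)[OF cxB]
lemmas D_0 = cxD(3)[OF cxB]
lemmas D_D = cxD(5)[OF cxB]
lemmas D_M = cx_M[OF cxB]

abbreviation chain :: "nat \<Rightarrow> (nat \<Rightarrow> ('i \<Rightarrow> 'r) \<Rightarrow> 'i \<Rightarrow> 'r) \<Rightarrow> bool" where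
  "chain \<equiv> cm B D B D"

lemma E_z: "E z \<in> M 0 (B 0)"
  by (simp add: B_0 E_in)

lemma D_M0: "x \<in> M 0 (B n) \<Longrightarrow> D n x \<in> M 0 (B (n - 1))"
  using D_M[of x 0 n] M_mono[of 0 1 "D n x"] by simp

section \<open>The tensor square of the resolution\<close>

definition T :: "nat \<Rightarrow> (nat \<times> 'i \<times> 'i) set" where
  "T n = (SIGMA q:{..n}. B q \<times> B (n - q))"

definition tens :: "nat \<Rightarrow> ('i \<Rightarrow> 'r) \<Rightarrow> ('i \<Rightarrow> 'r) \<Rightarrow> nat \<times> 'i \<times> 'i \<Rightarrow> 'r" where
  "tens q w u = (\<lambda>(q', j, i). if q' = q then w j * u i else 0)"

lemma finT [simp]: "finite (T n)"
  by (simp add: T_def)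

lemma T_cases:
  assumes "x \<in> T n"
  obtains q p j i where "n = q + p" "j \<in> B q" "i \<in> B p" "x = (q, j, i)"
  using assms by (auto simp: T_def dest!: le_Suc_ex)

lemma lin_tens: "lin (\<lambda>w. tens q w u)" "lin (tens q w)"
  by (auto simp: lin_def tens_def fun_eq_iff vscale_def algebra_simps)

lemma tens_0 [simp]: "tens q 0 u = 0" "tens q w 0 = 0"
  using linD(3)[OF lin_tens(1)] linD(3)[OF lin_tens(2)] by blast+

lemma tens_E: "tens q (E j) (E i) = E (q, j, i)"
  by (auto simp: tens_def E_def fun_eq_iff e_idem)

lemma tens_M: "w \<in> M k (B q) \<Longrightarrow> u \<in> M l (B p) \<Longrightarrow> tens q w u \<in> M (k + l) (T (q + p))"
  using I_zero by (auto simp: M_def tens_def T_def I_mult)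

lemma lin_T_M:
  assumes f: "lin f" and x: "x \<in> M k (T n)"
    and b: "\<And>q p j i. n = q + p \<Longrightarrow> j \<in> B q \<Longrightarrow> i \<in> B p \<Longrightarrow> f (tens q (E j) (E i)) \<in> M l C"
  shows "f x \<in> M (k + l) C"
proof (rule lin_M[OF f finT _ x])
  fix y assume "y \<in> T n"
  then obtain q p j i where "n = q + p" "j \<in> B q" "i \<in> B p" "y = (q, j, i)" by (rule T_cases)
  then show "f (E y) \<in> M l C" using b by (simp add: tens_E)
qed

lemma lin_T_eq:
  assumes f: "lin f" and g: "lin g" and x: "x \<in> M k (T n)"
    and b: "\<And>q p j i. n = q + p \<Longrightarrow> j \<in> B q \<Longrightarrow> i \<in> B p \<Longrightarrow> f (tens q (E j) (E i)) = g (tens q (E j) (E i))"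
  shows "f x = g x"
proof (rule lin_eq[OF f g finT _ x])
  fix y assume "y \<in> T n"
  then obtain q p j i where "n = q + p" "j \<in> B q" "i \<in> B p" "y = (q, j, i)" by (rule T_cases)
  then show "f (E y) = g (E y)" using b by (simp add: tens_E)
qed

definition from_tens :: "(nat \<Rightarrow> nat \<Rightarrow> ('i \<Rightarrow> 'r) \<Rightarrow> ('i \<Rightarrow> 'r) \<Rightarrow> 'j \<Rightarrow> 'r) \<Rightarrow> nat
    \<Rightarrow> (nat \<times> 'i \<times> 'i \<Rightarrow> 'r) \<Rightarrow> 'j \<Rightarrow> 'r" where
  "from_tens \<Phi> n = ext (T n) (\<lambda>(q, j, i). \<Phi> q (n - q) (E j) (E i))"

lemma lin_from_tens: "lin (from_tens \<Phi> n)"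
  by (simp add: from_tens_def lin_ext)

text \<open>The universal property of the tensor product: both sides are bilinear and agree on pairs
  of basis vectors. Hypothesis \<open>b\<close> makes these values fixed by \<open>e\<close>, as
  \<open>ext_E\<close> requires.\<close>

lemma from_tens:
  assumes 1: "\<And>q p u. lin (\<lambda>w. \<Phi> q p w u)" and 2: "\<And>q p w. lin (\<Phi> q p w)"
    and b: "\<And>j i. j \<in> B q \<Longrightarrow> i \<in> B p \<Longrightarrow> \<Phi> q p (E j) (E i) \<in> M l C"
    and w: "w \<in> M k (B q)" and u: "u \<in> M k' (B p)"
  shows "from_tens \<Phi> (q + p) (tens q w u) = \<Phi> q p w u"
proof -
  have *: "from_tens \<Phi> (q + p) (tens q (E j) (E i)) = \<Phi> q p (E j) (E i)"
    if "j \<in> B q" "i \<in> B p" for i j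
    using ext_E[of "T (q + p)" "(q, j, i)" "\<lambda>(q', j, i). \<Phi> q' (q + p - q') (E j) (E i)" l C] that b
    by (simp add: from_tens_def tens_E) (simp add: T_def)
  have "from_tens \<Phi> (q + p) (tens q (E j) u) = \<Phi> q p (E j) u" if "j \<in> B q" for j
    by (rule lin_eq[OF lin_comp[OF lin_from_tens lin_tens(2)] 2 finB * u]) (use that in auto)
  then show ?thesis
    by (intro lin_eq[OF lin_comp[OF lin_from_tens lin_tens(1)] 1 finB _ w])
qed

text \<open>The differential of \<open>F \<otimes> F\<close>; the truncated \<open>q - 1\<close> is harmless since \<open>D 0 = 0\<close>.\<close>

definition DT :: "nat \<Rightarrow> (nat \<times> 'i \<times> 'i \<Rightarrow> 'r) \<Rightarrow> nat \<times> 'i \<times> 'i \<Rightarrow> 'r" where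
  "DT = from_tens (\<lambda>q p w u. tens (q - 1) (D q w) u + sg q (tens q w (D p u)))"

lemma tens_D_M:
  assumes w: "w \<in> M k (B q)" and u: "u \<in> M l (B p)"
  shows "tens (q - 1) (D q w) u \<in> M (Suc (k + l)) (T (q + p - 1))"
    "tens q w (D p u) \<in> M (Suc (k + l)) (T (q + p - 1))"
proof -
  show "tens (q - 1) (D q w) u \<in> M (Suc (k + l)) (T (q + p - 1))"
    using tens_M[OF D_M[OF w] u] by (cases q) (auto simp: D_0)
  show "tens q w (D p u) \<in> M (Suc (k + l)) (T (q + p - 1))"
    using tens_M[OF w D_M[OF u]] by (cases p) (auto simp: D_0)
qed

lemma DT_tens:
  assumes w: "w \<in> M k (B q)" and u: "u \<in> M l (B p)"
  shows "DT (q + p) (tens q w u) = tens (q - 1) (D q w) u + sg q (tens q w (D p u))"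
  unfolding DT_def
proof (rule from_tens[OF _ _ _ w u])
  show "lin (\<lambda>w. tens (q - 1) (D q w) u + sg q (tens q w (D p u)))" for q p u
    by (intro lin_add lin_sg lin_comp[OF lin_tens(1) linDiff] lin_tens(1))
  show "lin (\<lambda>u. tens (q - 1) (D q w) u + sg q (tens q w (D p u)))" for q p w
    by (intro lin_add lin_sg lin_comp[OF lin_tens(2) linDiff] lin_tens(2))
  show "tens (q - 1) (D q (E j)) (E i) + sg q (tens q (E j) (D p (E i))) \<in> M 1 (T (q + p - 1))"
    if "j \<in> B q" "i \<in> B p" for j i
    using tens_D_M[OF E_in E_in, OF that] by (intro M_add M_sg) auto
qed

lemma lin_DT: "lin (DT n)"
  by (simp add: DT_def lin_from_tens)

lemma cx_T: "cx T DT"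
  unfolding cx_def
proof (intro conjI allI impI finT lin_DT)
  show "DT 0 = 0"
  proof
    fix x
    have "from_tens (\<lambda>q p w u. tens (q - 1) (D q w) u + sg q (tens q w (D p u))) 0 x = 0"
      by (auto simp: from_tens_def ext_def T_def D_0 sg_simps vscale_simps intro!: sum.neutral)
    then show "DT 0 x = 0 x" by (simp add: DT_def)
  qed
  fix n and x :: "nat \<times> 'i \<times> 'i \<Rightarrow> 'r" assume x: "x \<in> M 0 (T n)"
  have *: "DT n y \<in> M (k + 1) (T (n - 1))" if "y \<in> M k (T n)" for k y
  proof (rule lin_T_M[OF lin_DT that])
    fix q p j i assume "n = q + p" "j \<in> B q" "i \<in> B p"
    then show "DT n (tens q (E j) (E i)) \<in> M 1 (T (n - 1))"
      using DT_tens[OF E_in E_in, of j q i p] tens_D_M[OF E_in E_in, of j q i p]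
      by (auto intro!: M_add M_sg)
  qed
  from this[OF x] show "DT n x \<in> M 1 (T (n - 1))" by simp
  show "DT (n - 1) (DT n x) = 0"
  proof (rule lin_T_eq[OF lin_comp[OF lin_DT lin_DT] lin_zero(1) x])
    fix q p j i assume n: "n = q + p" and j: "j \<in> B q" and i: "i \<in> B p"
    note Ej = E_in[OF j] and Ei = E_in[OF i]
    have 1: "DT (n - 1) (tens (q - 1) (D q (E j)) (E i)) = sg (q - 1) (tens (q - 1) (D q (E j)) (D p (E i)))"
      using DT_tens[OF D_M0[OF Ej] Ei] D_D[OF Ej] n
      by (cases q) (auto simp: D_0 sg_simps linD(3)[OF lin_DT])
    have 2: "DT (n - 1) (tens q (E j) (D p (E i))) = tens (q - 1) (D q (E j)) (D p (E i))"
      using DT_tens[OF Ej D_M0[OF Ei]] D_D[OF Ei] n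
      by (cases p) (auto simp: D_0 sg_simps linD(3)[OF lin_DT])
    have "DT n (tens q (E j) (E i)) = tens (q - 1) (D q (E j)) (E i) + sg q (tens q (E j) (D p (E i)))"
      using DT_tens[OF Ej Ei] n by simp
    then have "DT (n - 1) (DT n (tens q (E j) (E i)))
      = sg (q - 1) (tens (q - 1) (D q (E j)) (D p (E i))) + sg q (tens (q - 1) (D q (E j)) (D p (E i)))"
      using 1 2 by (simp add: linD[OF lin_DT])
    \<comment> \<open>For positive \<open>q\<close> the signs of \<open>q - 1\<close> and
      \<open>q\<close> are opposite. For \<open>q = 0\<close> the truncated \<open>q - 1\<close>
      gives no cancellation, but \<open>D 0 = 0\<close>.\<close>
    also have "\<dots> = 0" by (cases q) (auto simp: D_0 sg_def)
    finally show "DT (n - 1) (DT n (tens q (E j) (E i))) = 0" .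
  qed
qed

lemma T_0: "T 0 = {(0, z, z)}"
  by (auto simp: T_def B_0)

text \<open>The product \<open>F \<otimes> F \<rightarrow> F\<close>, normalised by
  \<open>1 * 1 = 1\<close> in degree 0. Such a lift is unique only up to homotopy, so one is
  selected by \<open>SOME\<close>.\<close>

definition mu :: "nat \<Rightarrow> (nat \<times> 'i \<times> 'i \<Rightarrow> 'r) \<Rightarrow> 'i \<Rightarrow> 'r" where
  "mu = (SOME g. cm T DT B D 0 g \<and> g 0 (E (0, z, z)) = E z)"

lemma mu: "cm T DT B D 0 mu" "mu 0 (E (0, z, z)) = E z"
proof -
  obtain g where "cm T DT B D 0 g" "\<And>i. i \<in> T 0 \<Longrightarrow> g 0 (E i) = E z"
    by (rule lift[OF cx_T res, of 0 "\<lambda>_. E z"]) (auto simp: E_z)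
  then have "cm T DT B D 0 g \<and> g 0 (E (0, z, z)) = E z" by (auto simp: T_0)
  from someI[of "\<lambda>g. cm T DT B D 0 g \<and> g 0 (E (0, z, z)) = E z", OF this]
  show "cm T DT B D 0 mu" "mu 0 (E (0, z, z)) = E z" by (auto simp: mu_def)
qed

definition mul :: "nat \<Rightarrow> nat \<Rightarrow> ('i \<Rightarrow> 'r) \<Rightarrow> ('i \<Rightarrow> 'r) \<Rightarrow> 'i \<Rightarrow> 'r" where
  "mul q p w u = mu (q + p) (tens q w u)"

lemma lin_mul: "lin (\<lambda>w. mul q p w u)" "lin (mul q p w)"
  unfolding mul_def by (intro lin_comp[OF cmD(1)[OF mu(1)]] lin_tens)+

lemma mul_0 [simp]: "mul q p 0 u = 0" "mul q p w 0 = 0"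
  using linD(3)[OF lin_mul(1)] linD(3)[OF lin_mul(2)] by blast+

lemma mul_M: "w \<in> M k (B q) \<Longrightarrow> u \<in> M l (B p) \<Longrightarrow> mul q p w u \<in> M (k + l) (B (q + p))"
  using cm_M[OF mu(1) cx_T tens_M, of w k q u l p] by (simp add: mul_def)

lemma D_mul:
  assumes w: "w \<in> M 0 (B q)" and u: "u \<in> M 0 (B p)"
  shows "D (q + p) (mul q p w u) = mul (q - 1) p (D q w) u + sg q (mul q (p - 1) w (D p u))"
proof -
  have "D (q + p) (mul q p w u) = mu (q + p - 1) (DT (q + p) (tens q w u))"
    using cmD(4)[OF mu(1) tens_M[OF w u, simplified]] by (simp add: mul_def)
  also have "\<dots> = mu (q + p - 1) (tens (q - 1) (D q w) u) + sg q (mu (q + p - 1) (tens q w (D p u)))"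
    by (simp add: DT_tens[OF w u] linD[OF cmD(1)[OF mu(1)]])
  also have "mu (q + p - 1) (tens (q - 1) (D q w) u) = mul (q - 1) p (D q w) u"
    by (cases q) (auto simp: D_0 mul_def linD[OF cmD(1)[OF mu(1)]])
  also have "mu (q + p - 1) (tens q w (D p u)) = mul q (p - 1) w (D p u)"
    by (cases p) (auto simp: D_0 mul_def linD[OF cmD(1)[OF mu(1)]])
  finally show ?thesis .
qed

lemma mul_z_z: "mul 0 0 (E z) (E z) = E z"
  by (simp add: mul_def tens_E mu(2))

text \<open>Multiplication by \<open>E z\<close> is a chain map that agrees with the identity on the
  generator of \<open>F_0\<close>, so \<open>cm_minimal\<close> applies to the difference.\<close>

lemma mul_unit_left:
  assumes u: "u \<in> M 0 (B p)" shows "mul 0 p (E z) u - u \<in> M 1 (B p)"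
proof -
  have "chain 0 (\<lambda>n u. mul 0 n (E z) u)"
    unfolding cm_def using mul_M[OF E_z, of _ 0] D_mul[OF E_z]
    by (auto simp: lin_mul D_0 sg_simps)
  from cm_diff[OF this cm_id[OF cxB] cxB]
  have "chain 0 (\<lambda>n u. mul 0 n (E z) u - u)" .
  from cm_minimal[OF cxB res this _ u] show ?thesis
    by (simp add: B_0 mul_z_z)
qed

lemma mul_unit_right:
  assumes w: "w \<in> M 0 (B q)" shows "mul q 0 w (E z) - w \<in> M 1 (B q)"
proof -
  have "chain 0 (\<lambda>n w. mul n 0 w (E z))"
    unfolding cm_def using mul_M[OF _ E_z, of _ 0] D_mul[OF _ E_z]
    by (auto simp: lin_mul D_0 sg_simps)
  from cm_diff[OF this cm_id[OF cxB] cxB]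
  have "chain 0 (\<lambda>n w. mul n 0 w (E z) - w)" .
  from cm_minimal[OF cxB res this _ w] show ?thesis
    by (simp add: B_0 mul_z_z)
qed

section \<open>Tensor products of chain maps and the coproduct formula\<close>

lemma cm_tens:
  assumes f: "chain s f" and g: "chain r g"
  shows "\<exists>h. cm T DT T DT (s + r) h \<and> (\<forall>q p w u. w \<in> M 0 (B q) \<longrightarrow> u \<in> M 0 (B p) \<longrightarrow>
    h (q + p) (tens q w u) = sg (s * p) (tens (q - s) (f q w) (g p u)))"
proof -
  \<comment> \<open>Since \<open>f\<close> commutes strictly with \<open>D\<close> but lowers the
    left degree by \<open>s\<close>, the sign \<open>sg q\<close> in \<open>DT\<close> becomes
    \<open>sg (q - s)\<close>. The factor \<open>sg (s * p)\<close> compensates, because passing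
    from \<open>u\<close> to \<open>D p u\<close> changes its exponent by \<open>s\<close>.\<close>
  define \<Phi> where "\<Phi> q p w u = sg (s * p) (tens (q - s) (f q w) (g p u))" for q p w u
  have lin\<Phi>: "lin (\<lambda>w. \<Phi> q p w u)" "lin (\<Phi> q p w)" for q p w u
    unfolding \<Phi>_def by (intro lin_sg lin_comp[OF lin_tens(1)] lin_comp[OF lin_tens(2)] cmD(1)[OF f] cmD(1)[OF g])+
  have \<Phi>M: "\<Phi> q p w u \<in> M 0 (T (q + p - (s + r)))" if "w \<in> M 0 (B q)" "u \<in> M 0 (B p)" for q p w u
  \<comment> \<open>When a degree is too small, the truncated differences need not add up, but then
    \<open>f q\<close> or \<open>g p\<close> is 0.\<close>
  proof (cases "q < s \<or> p < r")
    case True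
    then show ?thesis using cmD(2)[OF f, of q] cmD(2)[OF g, of p] by (auto simp: \<Phi>_def sg_simps)
  next
    case False
    then have "q + p - (s + r) = (q - s) + (p - r)" by simp
    then show ?thesis
      using tens_M[OF cmD(3)[OF f that(1)] cmD(3)[OF g that(2)]] by (auto simp: \<Phi>_def intro!: M_sg)
  qed
  let ?h = "from_tens \<Phi>"
  have h: "?h (q + p) (tens q w u) = \<Phi> q p w u" if "w \<in> M 0 (B q)" "u \<in> M 0 (B p)" for q p w u
  proof (rule from_tens[OF lin\<Phi> _ that])
    show "\<Phi> q p (E j) (E i) \<in> M 0 (T (q + p - (s + r)))" if "j \<in> B q" "i \<in> B p" for j i
      using \<Phi>M[OF E_in E_in, OF that] .
  qed
  have "cm T DT T DT (s + r) ?h"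
    unfolding cm_def
  proof (intro conjI allI impI lin_from_tens)
    show "?h n = 0" if "n < s + r" for n
    proof
      fix x
      have "\<Phi> q (n - q) (E j) (E i) = 0" if "q \<le> n" for q i j
      proof -
        have "q < s \<or> n - q < r" using that \<open>n < s + r\<close> by arith
        then show ?thesis using cmD(2)[OF f, of q] cmD(2)[OF g, of "n - q"] by (auto simp: \<Phi>_def sg_simps)
      qed
      then have "?h n x = 0"
        by (auto simp: from_tens_def ext_def T_def vscale_simps intro!: sum.neutral)
      then show "?h n x = 0 x" by simp
    qed
    fix n and x :: "nat \<times> 'i \<times> 'i \<Rightarrow> 'r" assume x: "x \<in> M 0 (T n)"
    have "?h n x \<in> M (0 + 0) (T (n - (s + r)))"
    proof (rule lin_T_M[OF lin_from_tens x])
      fix q p j i assume n: "n = q + p" and j: "j \<in> B q" and i: "i \<in> B p"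
      show "?h n (tens q (E j) (E i)) \<in> M 0 (T (n - (s + r)))"
        unfolding n h[OF E_in[OF j] E_in[OF i]] by (rule \<Phi>M[OF E_in[OF j] E_in[OF i]])
    qed
    then show "?h n x \<in> M 0 (T (n - (s + r)))" by simp
    show "DT (n - (s + r)) (?h n x) = ?h (n - 1) (DT n x)"
    proof (rule lin_T_eq[OF lin_comp[OF lin_DT lin_from_tens] lin_comp[OF lin_from_tens lin_DT] x])
      fix q p j i assume n: "n = q + p" and j: "j \<in> B q" and i: "i \<in> B p"
      define w u where "w = E j" and "u = E i"
      have w: "w \<in> M 0 (B q)" and u: "u \<in> M 0 (B p)" using E_in[OF j] E_in[OF i] by (auto simp: w_def u_def)
      have 1: "?h (n - 1) (tens (q - 1) (D q w) u) = \<Phi> (q - 1) p (D q w) u"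
        using h[OF D_M0[OF w] u] n linD(3)[OF lin\<Phi>(1)]
        by (cases q) (auto simp: D_0 linD(3)[OF lin_from_tens])
      have 2: "?h (n - 1) (tens q w (D p u)) = \<Phi> q (p - 1) w (D p u)"
        using h[OF w D_M0[OF u]] n linD(3)[OF lin\<Phi>(2)]
        by (cases p) (auto simp: D_0 linD(3)[OF lin_from_tens])
      have R: "?h (n - 1) (DT n (tens q w u)) = \<Phi> (q - 1) p (D q w) u + sg q (\<Phi> q (p - 1) w (D p u))"
        using 1 2 DT_tens[OF w u] n by (simp add: linD[OF lin_from_tens])
      have "DT (n - (s + r)) (\<Phi> q p w u) = \<Phi> (q - 1) p (D q w) u + sg q (\<Phi> q (p - 1) w (D p u))"
      proof (cases "q < s \<or> p < r")
        case True
        then show ?thesis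
          using cmD(2)[OF f, of q] cmD(2)[OF f, of "q - 1"] cmD(2)[OF g, of p] cmD(2)[OF g, of "p - 1"]
          by (auto simp: \<Phi>_def sg_simps linD[OF lin_DT])
      next
        case False
        then have "n - (s + r) = (q - s) + (p - r)" using n by simp
        then have "DT (n - (s + r)) (\<Phi> q p w u)
          = sg (s * p) (tens (q - s - 1) (D (q - s) (f q w)) (g p u))
            + sg (s * p + (q - s)) (tens (q - s) (f q w) (D (p - r) (g p u)))"
          using DT_tens[OF cmD(3)[OF f w] cmD(3)[OF g u]]
          by (simp add: \<Phi>_def linD[OF lin_DT] sg_simps)
        also have "D (q - s) (f q w) = f (q - 1) (D q w)" using cmD(4)[OF f w] .
        also have "D (p - r) (g p u) = g (p - 1) (D p u)" using cmD(4)[OF g u] .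
        also have "sg (s * p + (q - s)) (tens (q - s) (f q w) (g (p - 1) (D p u)))
          = sg (q + s * (p - 1)) (tens (q - s) (f q w) (g (p - 1) (D p u)))"
        proof (cases p)
          case 0
          then show ?thesis by (simp add: D_0 sg_simps linD(3)[OF cmD(1)[OF g]])
        next
          case (Suc p')
          have "even (s * p + (q - s)) = even (q + s * (p - 1))" using False Suc by auto
          then show ?thesis by (simp add: sg_def)
        qed
        finally show ?thesis by (simp add: \<Phi>_def sg_simps diff_commute fun_eq_iff)
      qed
      then show "DT (n - (s + r)) (?h n (tens q (E j) (E i))) = ?h (n - 1) (DT n (tens q (E j) (E i)))"
        using R h[OF w u] n by (simp add: w_def u_def)
    qed
  qed
  then show ?thesis using h unfolding \<Phi>_def by blast
qed

lemma choice2: "\<forall>a v. \<exists>g. Q a v g \<Longrightarrow> \<exists>F. \<forall>a v. Q a v (F a v)"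
  using someI_ex[of "Q a v" for a v] by (intro exI[of _ "\<lambda>a v. SOME g. Q a v g"]) blast

text \<open>A functional on the free module \<open>F_t\<close> extends to a chain map of degree
  \<open>-t\<close>; up to homotopy such maps are the classes in \<open>Ext^t(k, k)\<close>.\<close>

lemma dual_chain:
  assumes "\<And>i. i \<in> B t \<Longrightarrow> c i \<in> M 0 (B 0)"
  shows "\<exists>g. chain t g \<and> (\<forall>i \<in> B t. g t (E i) = c i)"
proof -
  obtain g where "chain t g" "\<And>i. i \<in> B t \<Longrightarrow> g t (E i) = c i"
    by (rule lift[OF cxB res, of t c]) (auto simp: assms)
  then show ?thesis by blast
qed

text \<open>Both sides are chain maps \<open>F \<otimes> F \<rightarrow> F\<close> of degree
  \<open>-s\<close>, evaluated at \<open>w \<otimes> u\<close>. By \<open>cm_minimal\<close> they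
  agree modulo \<open>m\<close> once they do so in source degree \<open>s\<close>, and the
  \<open>\<psi>' a v\<close> are chosen to ensure this. The separate term \<open>w \<psi>(u)\<close>
  corresponds to \<open>a = 0\<close>.\<close>

lemma coproduct:
  assumes \<psi>: "chain s \<psi>"
  shows "\<exists>\<chi> \<psi>'. (\<forall>a v. chain a (\<chi> a v))
    \<and> (\<forall>a v. v \<in> B a \<longrightarrow> a \<le> s \<longrightarrow> chain (s - a) (\<psi>' a v))
    \<and> (\<forall>q p w u. w \<in> M 0 (B q) \<longrightarrow> u \<in> M 0 (B p) \<longrightarrow>
      \<psi> (q + p) (mul q p w u) - mul q (p - s) w (\<psi> p u)
        - (\<Sum>(a, v)\<in>(SIGMA a:{1..s}. B a). sg (a * p) (mul (q - a) (p - (s - a)) (\<chi> a v q w) (\<psi>' a v p u)))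
      \<in> M 1 (B (q + p - s)))"
proof -
  \<comment> \<open>\<open>\<chi> a v\<close> will extend the functional dual to the basis element
    \<open>v\<close> of \<open>B a\<close>.\<close>
  have "\<forall>a v. \<exists>g. chain a g \<and> (\<forall>i \<in> B a. g a (E i) = (if i = v then E z else 0))"
    using dual_chain[of a "\<lambda>i. if i = v then E z else 0" for a v] E_z by simp
  from choice2[OF this] obtain \<chi> where \<chi>: "\<And>a v. chain a (\<chi> a v)"
    and \<chi>E: "\<And>a v i. i \<in> B a \<Longrightarrow> \<chi> a v a (E i) = (if i = v then E z else 0)" by blast
  \<comment> \<open>\<open>\<psi>' a v\<close> records \<open>u \<mapsto> \<psi>(v u)\<close> in
    target degree 0. Its sign cancels the factor \<open>sg (a * p)\<close> of the tensor product at
    \<open>p = s - a\<close>.\<close>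
  have "\<forall>a v. \<exists>g. v \<in> B a \<longrightarrow> a \<le> s \<longrightarrow> chain (s - a) g \<and>
      (\<forall>i \<in> B (s - a). g (s - a) (E i) = sg (a * (s - a)) (\<psi> s (mul a (s - a) (E v) (E i))))"
  proof (intro allI, goal_cases)
    case (1 a v)
    show ?case
    proof (cases "v \<in> B a \<and> a \<le> s")
      case True
      have "\<psi> s (mul a (s - a) (E v) (E i)) \<in> M 0 (B 0)" if "i \<in> B (s - a)" for i
        using cmD(3)[OF \<psi> , of "mul a (s - a) (E v) (E i)" s] mul_M[OF E_in E_in, of v a i "s - a"] True that
        by simp
      then have "\<exists>g. chain (s - a) g \<and>
        (\<forall>i \<in> B (s - a). g (s - a) (E i) = sg (a * (s - a)) (\<psi> s (mul a (s - a) (E v) (E i))))"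
        by (intro dual_chain M_sg)
      then show ?thesis by blast
    qed auto
  qed
  from choice2[OF this] obtain \<psi>' where \<psi>': "\<And>a v. v \<in> B a \<Longrightarrow> a \<le> s \<Longrightarrow> chain (s - a) (\<psi>' a v)"
    and \<psi>'E: "\<And>a v i. v \<in> B a \<Longrightarrow> a \<le> s \<Longrightarrow> i \<in> B (s - a) \<Longrightarrow>
      \<psi>' a v (s - a) (E i) = sg (a * (s - a)) (\<psi> s (mul a (s - a) (E v) (E i)))" by blast
  let ?S = "SIGMA a:{1..s}. B a"
  have "\<forall>a v. \<exists>h. (a, v) \<in> ?S \<longrightarrow> cm T DT T DT s h \<and> (\<forall>q p w u. w \<in> M 0 (B q) \<longrightarrow> u \<in> M 0 (B p) \<longrightarrow>
      h (q + p) (tens q w u) = sg (a * p) (tens (q - a) (\<chi> a v q w) (\<psi>' a v p u)))"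
  proof (intro allI, goal_cases)
    case (1 a v)
    show ?case
    proof (cases "(a, v) \<in> ?S")
      case True
      then have "chain (s - a) (\<psi>' a v)" and s: "a + (s - a) = s" using \<psi>' by auto
      from cm_tens[OF \<chi>[of a v] this(1)] show ?thesis unfolding s by blast
    qed auto
  qed
  from choice2[OF this] obtain \<tau> where \<tau>: "\<And>a v. (a, v) \<in> ?S \<Longrightarrow> cm T DT T DT s (\<tau> a v)"
    and \<tau>t: "\<And>a v q p w u. (a, v) \<in> ?S \<Longrightarrow> w \<in> M 0 (B q) \<Longrightarrow> u \<in> M 0 (B p) \<Longrightarrow>
      \<tau> a v (q + p) (tens q w u) = sg (a * p) (tens (q - a) (\<chi> a v q w) (\<psi>' a v p u))" by blast
  obtain \<tau>0 where "cm T DT T DT (0 + s) \<tau>0"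
    and "\<And>q p w u. w \<in> M 0 (B q) \<Longrightarrow> u \<in> M 0 (B p) \<Longrightarrow>
      \<tau>0 (q + p) (tens q w u) = sg (0 * p) (tens (q - 0) w (\<psi> p u))"
    using cm_tens[OF cm_id[OF cxB] \<psi>] by blast
  then have \<tau>0: "cm T DT T DT s \<tau>0"
    and \<tau>0t: "\<And>q p w u. w \<in> M 0 (B q) \<Longrightarrow> u \<in> M 0 (B p) \<Longrightarrow> \<tau>0 (q + p) (tens q w u) = tens q w (\<psi> p u)"
    by (simp_all add: sg_simps)
  define \<Psi> where "\<Psi> n x = \<psi> n (mu n x) - mu (n - s) (\<tau>0 n x)
    - (\<Sum>i\<in>?S. mu (n - s) (\<tau> (fst i) (snd i) n x))" for n x
  have "cm T DT B D s (\<lambda>n x. \<psi> n (mu n x))" using cm_comp[OF mu(1) \<psi>] by simp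
  moreover have "cm T DT B D s (\<lambda>n x. mu (n - s) (\<tau>0 n x))" using cm_comp[OF \<tau>0 mu(1)] by simp
  moreover have "cm T DT B D s (\<lambda>n x. \<Sum>i\<in>?S. mu (n - s) (\<tau> (fst i) (snd i) n x))"
  proof (rule cm_sum[OF _ cxB])
    fix i assume "i \<in> ?S"
    then have "cm T DT T DT s (\<tau> (fst i) (snd i))" using \<tau>[of "fst i" "snd i"] by simp
    from cm_comp[OF this mu(1)] show "cm T DT B D s (\<lambda>n x. mu (n - s) (\<tau> (fst i) (snd i) n x))" by simp
  qed
  ultimately have \<Psi>: "cm T DT B D s \<Psi>"
    unfolding \<Psi>_def[abs_def] by (intro cm_diff cxB)
  have \<Psi>t: "\<Psi> (q + p) (tens q w u) = \<psi> (q + p) (mul q p w u) - mul q (p - s) w (\<psi> p u)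
        - (\<Sum>(a, v)\<in>?S. sg (a * p) (mul (q - a) (p - (s - a)) (\<chi> a v q w) (\<psi>' a v p u)))"
    if w: "w \<in> M 0 (B q)" and u: "u \<in> M 0 (B p)" for q p w u
  proof -
    have "mu (q + p - s) (\<tau> a v (q + p) (tens q w u))
      = sg (a * p) (mul (q - a) (p - (s - a)) (\<chi> a v q w) (\<psi>' a v p u))" if av: "(a, v) \<in> ?S" for a v
    proof -
      have "mu (q + p - s) (tens (q - a) (\<chi> a v q w) (\<psi>' a v p u))
        = mul (q - a) (p - (s - a)) (\<chi> a v q w) (\<psi>' a v p u)"
      proof (cases "q < a \<or> p < s - a")
        case True
        then have "\<chi> a v q w = 0 \<or> \<psi>' a v p u = 0"
          using cmD(2)[OF \<chi>[of a v], of q] cmD(2)[OF \<psi>'[of v a], of p] av by auto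
        then show ?thesis by (auto simp: linD[OF cmD(1)[OF mu(1)]])
      next
        case False
        then have "q + p - s = (q - a) + (p - (s - a))" using av by auto
        then show ?thesis by (simp add: mul_def)
      qed
      then show ?thesis by (simp add: \<tau>t[OF av w u] linD[OF cmD(1)[OF mu(1)]])
    qed
    then have "mu (q + p - s) (\<tau> (fst i) (snd i) (q + p) (tens q w u)) = (case i of (a, v) \<Rightarrow>
        sg (a * p) (mul (q - a) (p - (s - a)) (\<chi> a v q w) (\<psi>' a v p u)))" if "i \<in> ?S" for i
      using that by (cases i) (simp only: split fst_conv snd_conv)
    then have "(\<Sum>i\<in>?S. mu (q + p - s) (\<tau> (fst i) (snd i) (q + p) (tens q w u))) = (\<Sum>(a, v)\<in>?S.
        sg (a * p) (mul (q - a) (p - (s - a)) (\<chi> a v q w) (\<psi>' a v p u)))"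
      by (rule sum.cong[OF refl])
    moreover have "mu (q + p - s) (tens q w (\<psi> p u)) = mul q (p - s) w (\<psi> p u)"
    proof (cases "p < s")
      case True
      then show ?thesis using cmD(2)[OF \<psi> True] by (auto simp: linD[OF cmD(1)[OF mu(1)]])
    qed (simp add: mul_def)
    ultimately show ?thesis
      by (simp only: \<Psi>_def mul_def[of q p] \<tau>0t[OF w u])
  qed
  have "\<Psi> s (E y) \<in> M 1 (B 0)" if "y \<in> T s" for y
  proof -
    from that obtain q p j i where s: "s = q + p" and j: "j \<in> B q" and i: "i \<in> B p" and y: "y = (q, j, i)"
      by (rule T_cases)
    note Ej = E_in[OF j] and Ei = E_in[OF i]
    have eq: "\<Psi> s (E y) = \<psi> s (mul q p (E j) (E i)) - mul q (p - s) (E j) (\<psi> p (E i))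
        - (\<Sum>(a, v)\<in>?S. sg (a * p) (mul (q - a) (p - (s - a)) (\<chi> a v q (E j)) (\<psi>' a v p (E i))))"
      using \<Psi>t[OF Ej Ei] by (simp add: s y tens_E)
    show ?thesis
    \<comment> \<open>For \<open>q = 0\<close> every \<open>\<chi> a v\<close> with positive
      \<open>a\<close> kills \<open>E j\<close>, and only the left unit law remains.\<close>
    proof (cases "q = 0")
      case True
      have "(case x of (a, v) \<Rightarrow> sg (a * p) (mul (q - a) (p - (s - a)) (\<chi> a v q (E j)) (\<psi>' a v p (E i)))) = 0"
        if "x \<in> ?S" for x
        using that cmD(2)[OF \<chi>, of q "fst x" "snd x"] True by (auto simp: sg_simps)
      then have "\<Psi> s (E y) = \<psi> s (mul 0 s (E z) (E i)) - mul 0 0 (E z) (\<psi> s (E i))"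
        using eq True s j by (simp add: sum.neutral B_0)
      also have "\<dots> = \<psi> s (mul 0 s (E z) (E i) - E i) - (mul 0 0 (E z) (\<psi> s (E i)) - \<psi> s (E i))"
        by (simp add: linD[OF cmD(1)[OF \<psi>]])
      finally have eq': "\<Psi> s (E y) = \<dots>" .
      have Eis: "E i \<in> M 0 (B s)" using Ei s True by simp
      have "\<psi> s (E i) \<in> M 0 (B 0)" using cmD(3)[OF \<psi> Eis] by simp
      then have 1: "mul 0 0 (E z) (\<psi> s (E i)) - \<psi> s (E i) \<in> M 1 (B 0)" by (rule mul_unit_left)
      have "mul 0 s (E z) (E i) - E i \<in> M 1 (B s)" by (rule mul_unit_left[OF Eis])
      then have "\<psi> s (mul 0 s (E z) (E i) - E i) \<in> M 1 (B (s - s))" by (rule cm_M[OF \<psi> cxB])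
      then have "\<psi> s (mul 0 s (E z) (E i) - E i) \<in> M 1 (B 0)" by simp
      from M_diff[OF this 1] show ?thesis unfolding eq' .
    next
      case False
      \<comment> \<open>Now \<open>\<psi> p\<close> is 0. The sum reduces to the term
        \<open>(q, j)\<close>: \<open>\<chi>\<close> vanishes for \<open>a > q\<close>,
        \<open>\<psi>'\<close> for \<open>a < q\<close>, and duality excludes the other
        \<open>v\<close> for \<open>a = q\<close>.\<close>
      then have ps: "p < s" using s by simp
      let ?x = "\<psi> s (mul q p (E j) (E i))"
      have x: "?x \<in> M 0 (B 0)"
        using cm_M[OF \<psi> cxB mul_M[OF Ej Ei]] s by simp
      have qj: "(q, j) \<in> ?S" using False s j by auto
      have "(case x of (a, v) \<Rightarrow> sg (a * p) (mul (q - a) (p - (s - a)) (\<chi> a v q (E j)) (\<psi>' a v p (E i)))) = 0"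
        if "x \<in> ?S - {(q, j)}" for x
      proof -
        obtain a v where x: "x = (a, v)" by (cases x)
        then have av: "x = (a, v)" "(a, v) \<in> ?S" "(a, v) \<noteq> (q, j)" using that by blast+
        consider "q < a" | "a < q" | "a = q" by linarith
        then have "\<chi> a v q (E j) = 0 \<or> \<psi>' a v p (E i) = 0"
        proof cases
          case 1 then show ?thesis using cmD(2)[OF \<chi>[of a v]] by auto
        next
          case 2
          then have "p < s - a" using s by simp
          then show ?thesis using cmD(2)[OF \<psi>'[of v a]] av by auto
        next
          case 3 then show ?thesis using \<chi>E[of j a v] j av by auto
        qed
        then show ?thesis using av by (auto simp: sg_simps)
      qed
      then have "(\<Sum>(a, v)\<in>?S. sg (a * p) (mul (q - a) (p - (s - a)) (\<chi> a v q (E j)) (\<psi>' a v p (E i))))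
        = sg (q * p) (mul 0 (p - (s - q)) (\<chi> q j q (E j)) (\<psi>' q j p (E i)))"
        using qj by (subst sum.remove[OF _ qj]) auto
      also have "\<dots> = mul 0 0 (E z) ?x"
        using \<chi>E[OF j, of j] \<psi>'E[of j q i] j i s by (simp add: linD[OF lin_mul(2)] sg_simps) (simp add: sg_def)
      finally have "\<Psi> s (E y) = - (mul 0 0 (E z) ?x - ?x)"
        using eq cmD(2)[OF \<psi> ps] by simp
      then show ?thesis using M_minus[OF mul_unit_left[OF x]] by simp
    qed
  qed
  then have "\<Psi> (q + p) (tens q w u) \<in> M 1 (B (q + p - s))"
    if "w \<in> M 0 (B q)" "u \<in> M 0 (B p)" for q p w u
    using cm_minimal[OF cx_T res \<Psi> _ tens_M[OF that, simplified]] by blast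
  then have "\<psi> (q + p) (mul q p w u) - mul q (p - s) w (\<psi> p u)
        - (\<Sum>(a, v)\<in>?S. sg (a * p) (mul (q - a) (p - (s - a)) (\<chi> a v q w) (\<psi>' a v p u)))
      \<in> M 1 (B (q + p - s))" if "w \<in> M 0 (B q)" "u \<in> M 0 (B p)" for q p w u
    unfolding \<Psi>t[OF that, symmetric] using that .
  then show ?thesis using \<chi> \<psi>' by blast
qed

section \<open>Descending exactness\<close>

lemma lin_image:
  assumes f: "lin f"
  shows "0 \<in> f ` M k A" "y \<in> f ` M k A \<Longrightarrow> y' \<in> f ` M k A \<Longrightarrow> y + y' \<in> f ` M k A"
    "y \<in> f ` M k A \<Longrightarrow> y' \<in> f ` M k A \<Longrightarrow> y - y' \<in> f ` M k A"
proof -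
  have "f 0 \<in> f ` M k A" by (rule imageI[OF M_zero])
  then show "0 \<in> f ` M k A" by (simp only: linD(3)[OF f])
next
  assume "y \<in> f ` M k A" "y' \<in> f ` M k A"
  then obtain a b where ab: "a \<in> M k A" "b \<in> M k A" "y = f a" "y' = f b" by blast
  have "f (a + b) \<in> f ` M k A" "f (a - b) \<in> f ` M k A"
    using ab by (auto intro!: imageI M_add M_diff)
  then show "y + y' \<in> f ` M k A" "y - y' \<in> f ` M k A"
    by (simp_all only: linD[OF f] ab)
qed

text \<open>Hypothesis \<open>ne\<close> supplies a basis element in degree \<open>n + 1\<close>,
  hence a chain map that hits 1 and lowers degrees by more than \<open>n\<close>.\<close>

lemma socle_boundary_step:
  assumes ne: "\<And>t. B t \<noteq> {}"
    and ind: "\<And>n' x. n < n' \<Longrightarrow> x \<in> M 3 (B n') \<Longrightarrow> \<exists>y \<in> M 2 (B (Suc n')). D (Suc n') y = x"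
    and x: "x \<in> M 3 (B n)"
  shows "\<exists>y \<in> M 2 (B (Suc n)). D (Suc n) y = x"
proof -
  let ?Im = "D (Suc n) ` M 2 (B (Suc n))"
  define W where "W = {y \<in> M 0 (B n). \<forall>s \<in> I 3. vscale s y \<in> ?Im}"
  note Im_0 = lin_image(1)[OF linDiff] and Im_add = lin_image(2)[OF linDiff]
    and Im_diff = lin_image(3)[OF linDiff]
  have Im_sum: "(\<Sum>a\<in>A. f a) \<in> ?Im" if "\<And>a. a \<in> A \<Longrightarrow> f a \<in> ?Im" for A and f :: "'i \<Rightarrow> _"
    using that by (induction A rule: infinite_finite_induct) (simp_all only: sum.infinite sum.empty sum.insert Im_0 Im_add insert_iff simp_thms)
  have W_add: "y + y' \<in> W" if "y \<in> W" "y' \<in> W" for y y'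
    using that by (auto simp: W_def vscale_simps intro: M_add Im_add)
  have W_diff: "y - y' \<in> W" if "y \<in> W" "y' \<in> W" for y y'
    using that by (auto simp: W_def vscale_simps intro: M_diff Im_diff)
  \<comment> \<open>Here \<open>m^4 = 0\<close> enters: \<open>m^3\<close> annihilates
    \<open>m F\<close>.\<close>
  have W_1: "y \<in> W" if y: "y \<in> M 1 (B n)" for y
  proof -
    have "vscale s y = 0" if "s \<in> I 3" for s
      using M_4[of 4, OF _ M_scale_I[OF that y, simplified]] by simp
    then show ?thesis using M_mono[OF _ y, of 0] Im_0 by (simp add: W_def)
  qed
  have W_0: "0 \<in> W" by (rule W_1) simp
  have W_sum: "(\<Sum>a\<in>A. f a) \<in> W" if "\<And>a. a \<in> A \<Longrightarrow> f a \<in> W" for A and f :: "nat \<times> 'i \<Rightarrow> _"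
    using that by (induction A rule: infinite_finite_induct) (simp_all only: sum.infinite sum.empty sum.insert W_0 W_add insert_iff simp_thms)
  have W_sg: "sg k y \<in> W" if "y \<in> W" for k y
    using W_diff[OF W_0 that] that by (simp add: sg_def)
  \<comment> \<open>Since \<open>n + s > n\<close>, \<open>ind\<close> writes \<open>r y\<close> as
    a boundary from \<open>m^2 F\<close>, and \<open>\<psi>\<close> carries this to degree
    \<open>n\<close>.\<close>
  have W_chain: "\<psi> (n + s) y \<in> W" if \<psi>: "chain s \<psi>" and s: "0 < s" and y: "y \<in> M 0 (B (n + s))" for \<psi> s y
  proof -
    have "vscale r (\<psi> (n + s) y) \<in> ?Im" if r: "r \<in> I 3" for r
    proof -
      have "vscale r y \<in> M 3 (B (n + s))" using M_scale_I[OF r y] by simp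
      then obtain y' where y': "y' \<in> M 2 (B (Suc (n + s)))" "D (Suc (n + s)) y' = vscale r y"
        using ind[of "n + s"] s by auto
      have "D (Suc n) (\<psi> (Suc (n + s)) y') = vscale r (\<psi> (n + s) y)"
        using cmD(4)[OF \<psi> M_mono[OF _ y'(1), of 0]] y'(2) by (simp add: linD[OF cmD(1)[OF \<psi>]] Suc_diff_le)
      moreover have "\<psi> (Suc (n + s)) y' \<in> M 2 (B (Suc n))"
        using cm_M[OF \<psi> cxB y'(1)] by (simp add: Suc_diff_le)
      ultimately show ?thesis by (metis imageI)
    qed
    then show ?thesis using cmD(3)[OF \<psi> y] by (simp add: W_def)
  qed
  \<comment> \<open>Induction on \<open>p\<close> for all \<open>\<psi>\<close> and
    \<open>s\<close>: a coproduct term with \<open>a \<le> p\<close> replaces \<open>p\<close> by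
    \<open>p - a\<close> and \<open>s\<close> by \<open>s - a\<close>, which preserves
    \<open>p < s\<close>; a term with \<open>a > p\<close> is 0.\<close>
  have claim: "mul p (n - p) w (\<psi> (n - p + s) u) \<in> W"
    if "p \<le> n" "p < s" "chain s \<psi>" "w \<in> M 0 (B p)" "u \<in> M 0 (B (n - p + s))" for p s \<psi> w u
    using that
  proof (induction p arbitrary: s \<psi> w u rule: less_induct)
    case (less p)
    obtain \<chi> \<psi>' where \<chi>: "\<And>a v. chain a (\<chi> a v)"
      and \<psi>': "\<And>a v. v \<in> B a \<Longrightarrow> a \<le> s \<Longrightarrow> chain (s - a) (\<psi>' a v)"
      and co: "\<psi> (p + (n - p + s)) (mul p (n - p + s) w u) - mul p (n - p + s - s) w (\<psi> (n - p + s) u)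
        - (\<Sum>(a, v)\<in>(SIGMA a:{1..s}. B a). sg (a * (n - p + s)) (mul (p - a) (n - p + s - (s - a)) (\<chi> a v p w) (\<psi>' a v (n - p + s) u)))
      \<in> M 1 (B (p + (n - p + s) - s))"
      using coproduct[OF less.prems(3)] less.prems(4,5) by blast
    let ?t = "\<lambda>(a, v). sg (a * (n - p + s)) (mul (p - a) (n - p + s - (s - a)) (\<chi> a v p w) (\<psi>' a v (n - p + s) u))"
    have t: "?t x \<in> W" if "x \<in> (SIGMA a:{1..s}. B a)" for x
    proof -
      obtain a v where x: "x = (a, v)" by (cases x)
      then have av: "x = (a, v)" "1 \<le> a" "a \<le> s" "v \<in> B a" using that by auto
      show ?thesis
      proof (cases "p < a")
        case True
        then show ?thesis using cmD(2)[OF \<chi>, of p a v] W_0 av by (simp add: sg_simps)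
      next
        case False
        have 1: "n - p + s - (s - a) = n - (p - a)" "n - p + s = n - (p - a) + (s - a)"
          using False av less.prems(1) by auto
        have "mul (p - a) (n - (p - a)) (\<chi> a v p w) (\<psi>' a v (n - (p - a) + (s - a)) u) \<in> W"
          using less.prems(1,2,5) False av 1(2)
          by (intro less.IH \<psi>' cmD(3)[OF \<chi> less.prems(4)]) auto
        then show ?thesis using av 1 by (auto intro: W_sg)
      qed
    qed
    have "mul p (n - p + s) w u \<in> M 0 (B (n + s))" using mul_M[OF less.prems(4,5)] less.prems(1) by simp
    then have "\<psi> (n + s) (mul p (n - p + s) w u) \<in> W" using W_chain less.prems(2,3) by simp
    moreover have "\<psi> (n + s) (mul p (n - p + s) w u) - mul p (n - p) w (\<psi> (n - p + s) u)
        - (\<Sum>x\<in>(SIGMA a:{1..s}. B a). ?t x) \<in> W"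
      using W_1 co less.prems(1) by simp
    ultimately have "\<psi> (n + s) (mul p (n - p + s) w u)
       - (\<psi> (n + s) (mul p (n - p + s) w u) - mul p (n - p) w (\<psi> (n - p + s) u)
        - (\<Sum>x\<in>(SIGMA a:{1..s}. B a). ?t x) + (\<Sum>x\<in>(SIGMA a:{1..s}. B a). ?t x)) \<in> W"
      by (intro W_diff[of "\<psi> (n + s) (mul p (n - p + s) w u)"] W_add W_sum t)
    then show ?case by simp
  qed
  obtain i where i: "i \<in> B (Suc n)" using ne by blast
  obtain \<psi> where \<psi>: "chain (Suc n) \<psi>" and \<psi>E: "\<psi> (Suc n) (E i) = E z"
    using dual_chain[of "Suc n" "\<lambda>_. E z"] E_z i by blast
  have "E j \<in> W" if j: "j \<in> B n" for j
  proof -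
    \<comment> \<open>The claim is used with \<open>p = n\<close> and \<open>s = n + 1\<close>; the
      right unit law then brings \<open>E j\<close> itself into \<open>W\<close>.\<close>
    have "mul n 0 (E j) (E z) \<in> W"
      using claim[of n "Suc n" \<psi> "E j" "E i"] \<psi> \<psi>E E_in[OF i] E_in[OF j] by simp
    from W_diff[OF this W_1[OF mul_unit_right[OF E_in[OF j]]]] show ?thesis by simp
  qed
  then have "vscale (x j) (E j) \<in> ?Im" if "j \<in> B n" for j
    using x that by (auto simp: W_def M_def)
  then have "x \<in> ?Im"
    by (subst M_expand[OF finB x]) (intro Im_sum)
  then show ?thesis by auto
qed

text \<open>A nonzero element of \<open>m^3\<close> times a basis vector is a cycle by
  \<open>m^4 = 0\<close> and lies in \<open>m F\<close>, so it is a nonzero boundary from the next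
  module.\<close>

lemma B_nonempty:
  assumes "I 3 \<noteq> {0}" shows "B t \<noteq> {}"
proof (induction t)
  case 0 then show ?case by (simp add: B_0)
next
  case (Suc t)
  obtain s where s: "s \<in> I 3" "s \<noteq> 0" using assms I_zero by blast
  obtain j where j: "j \<in> B t" using Suc by blast
  have x: "vscale s (E j) \<in> M 3 (B t)" using E_scale_in[OF j s(1)] .
  have "vscale s (E j) j = s" using I_e[OF s(1)] by (simp add: vscale_def E_def mult.commute)
  then have "vscale s (E j) \<noteq> 0" using s(2) by (metis zero_fun_apply)
  moreover have "D t (vscale s (E j)) = 0" using M_4[OF _ D_M[OF x]] by simp
  then obtain y where "y \<in> M 0 (B (Suc t))" "D (Suc t) y = vscale s (E j)"
    using resD(2)[OF res M_mono[OF _ x, of 0]] M_mono[OF _ x, of 1] by (cases t) auto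
  ultimately have "y \<noteq> 0" "y \<in> M 0 (B (Suc t))" using linD(3)[OF linDiff] by metis+
  then show ?case using M_empty by metis
qed

lemma socle_boundary:
  assumes N: "\<And>n x. N < n \<Longrightarrow> x \<in> M 3 (B n) \<Longrightarrow> \<exists>y \<in> M 2 (B (Suc n)). D (Suc n) y = x"
    and x: "x \<in> M 3 (B n)"
  shows "\<exists>y \<in> M 2 (B (Suc n)). D (Suc n) y = x"
proof (cases "I 3 = {0}")
  case True
  then have "x = 0" using x by (auto simp: M_def fun_eq_iff)
  then show ?thesis using linD(3)[OF linDiff] by (metis M_zero)
next
  case False
  have "\<forall>n x. N - k < n \<longrightarrow> x \<in> M 3 (B n) \<longrightarrow> (\<exists>y \<in> M 2 (B (Suc n)). D (Suc n) y = x)" for k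
  proof (induction k)
    case 0 then show ?case using N by simp
  next
    case (Suc k)
    show ?case
    proof (intro allI impI)
      fix n x assume n: "N - Suc k < n" and x: "x \<in> M 3 (B n)"
      have "N - k < n'" if "n < n'" for n' using n that by simp
      then show "\<exists>y \<in> M 2 (B (Suc n)). D (Suc n) y = x"
        using Suc.IH by (intro socle_boundary_step[OF B_nonempty[OF False] _ x]) blast
    qed
  qed
  note * = this
  show ?thesis
  \<comment> \<open>With \<open>k = N\<close> the truncated bound \<open>N - k\<close> is 0, so only
    positive degrees are covered; degree 0 takes one more step.\<close>
  proof (cases "n = 0")
    case True
    show ?thesis using *[of N] x True B_nonempty[OF False] by (intro socle_boundary_step[OF B_nonempty[OF False] _ x]) auto
  next
    case False
    then show ?thesis using *[of N] x by auto
  qed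
qed

text \<open>Representatives of the cycles of the linear part in layer \<open>i = 0\<close>, where
  the boundaries are represented by \<open>m F_n\<close>: \<open>K n \<subseteq> M 1 (B n)\<close>
  means that the homology there vanishes. For \<open>n = 0\<close> the set is all of
  \<open>F_0\<close>.\<close>

definition K :: "nat \<Rightarrow> ('i \<Rightarrow> 'r) set" where
  "K n = {x \<in> M 0 (B n). D n x \<in> M 2 (B (n - 1))}"

lemma chain_K:
  assumes f: "chain t f" and x: "x \<in> K n" shows "f n x \<in> K (n - t)"
  using assms cmD(3,4)[OF f] cm_M[OF f cxB, of "D n x" 2 "n - 1"]
  by (simp add: K_def diff_commute)

lemma K_minimal:
  assumes soc: "\<And>n x. x \<in> M 3 (B n) \<Longrightarrow> \<exists>y \<in> M 2 (B (Suc n)). D (Suc n) y = x"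
    and N: "\<And>n. N < n \<Longrightarrow> K n \<subseteq> M 1 (B n)" and n: "1 \<le> n"
  shows "K n \<subseteq> M 1 (B n)"
proof (rule ccontr)
  assume bad: "\<not> ?thesis"
  define X where "X = {n. 1 \<le> n \<and> \<not> K n \<subseteq> M 1 (B n)}"
  have X: "finite X" "X \<noteq> {}"
    using N bad n by (auto simp: X_def intro!: finite_subset[of _ "{..N}"] leI)
  define t where "t = Max X"
  define c where "c = Min X"
  have t: "t \<in> X" and c: "c \<in> X" and ct: "\<And>k. k \<in> X \<Longrightarrow> c \<le> k \<and> k \<le> t"
    using X by (auto simp: t_def c_def)
  then have c1: "1 \<le> c" and t1: "1 \<le> t" by (auto simp: X_def)
  obtain w where w: "w \<in> K t" "w \<notin> M 1 (B t)" using t by (auto simp: X_def)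
  obtain x where x: "x \<in> K c" "x \<notin> M 1 (B c)" using c by (auto simp: X_def)
  have w0: "w \<in> M 0 (B t)" and Dw: "D t w \<in> M 2 (B (t - 1))" using w(1) by (auto simp: K_def)
  have x0: "x \<in> M 0 (B c)" and Dx: "D c x \<in> M 2 (B (c - 1))" using x(1) by (auto simp: K_def)
  obtain v where v: "w v \<notin> I 1" using w(2) w0 by (auto simp: M_def)
  then have vB: "v \<in> B t" using w0 I_zero by (auto simp: M_def)
  \<comment> \<open>The coefficient of \<open>w\<close> at \<open>v\<close> is invertible modulo
    \<open>m\<close>; scaling the dual functional by \<open>r\<close> gives \<open>f(w) = 1\<close>
    modulo \<open>m\<close>.\<close>
  obtain r where r: "r * w v - e \<in> I 1" using I_max[of "w v"] v w0 by (auto simp: M_def)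
  have "(if i = v then vscale r (E z) else 0) \<in> M 0 (B 0)" for i
    using M_scale[OF E_z] by simp
  then have "\<exists>f. chain t f \<and> (\<forall>i \<in> B t. f t (E i) = (if i = v then vscale r (E z) else 0))"
    by (rule dual_chain)
  then obtain f where f: "chain t f" and fE: "\<And>i. i \<in> B t \<Longrightarrow> f t (E i) = (if i = v then vscale r (E z) else 0)"
    by blast
  have "f t w = (\<Sum>i\<in>B t. vscale (w i) (f t (E i)))" by (rule lin_expand[OF cmD(1)[OF f] finB w0])
  also have "\<dots> = (\<Sum>i\<in>B t. if i = v then vscale (r * w v) (E z) else 0)"
    by (rule sum.cong) (auto simp: fE vscale_simps mult.commute)
  also have "\<dots> = vscale (r * w v) (E z)" using vB by simp
  finally have fw: "f t w - E z \<in> M 1 (B 0)"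
    using E_scale_in[OF _ r, of z "B 0"] M_e[OF E_z] vscale_simps(6)[of "r * w v - e" e "E z"]
    by (simp add: B_0 algebra_simps)
  obtain \<chi> \<psi>' where \<chi>: "\<And>a v. chain a (\<chi> a v)"
    and \<psi>': "\<And>a v. v \<in> B a \<Longrightarrow> a \<le> t \<Longrightarrow> chain (t - a) (\<psi>' a v)"
    and co: "\<And>q p w u. w \<in> M 0 (B q) \<Longrightarrow> u \<in> M 0 (B p) \<Longrightarrow>
      f (q + p) (mul q p w u) - mul q (p - t) w (f p u)
        - (\<Sum>(a, v)\<in>(SIGMA a:{1..t}. B a). sg (a * p) (mul (q - a) (p - (t - a)) (\<chi> a v q w) (\<psi>' a v p u)))
      \<in> M 1 (B (q + p - t))"
    using coproduct[OF f] by blast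
  define q where "q = c - 1"
  \<comment> \<open>In the coproduct formula, \<open>f(w) = 1\<close> modulo \<open>m\<close>
    accounts for \<open>y\<close>. Each remaining term has \<open>a > q\<close>, where
    \<open>\<chi>\<close> is 0, or \<open>1 \<le> a \<le> q < c\<close>, where
    \<open>\<psi>'(w)\<close> lies in \<open>K a\<close>, hence in \<open>m F_a\<close> since
    \<open>c\<close> is the least exception.\<close>
  have E_mod: "f (q + t) (mul q t y w) - y \<in> M 1 (B q)" if y: "y \<in> M 0 (B q)" for y
  proof -
    let ?t = "\<lambda>(a, v). sg (a * t) (mul (q - a) (t - (t - a)) (\<chi> a v q y) (\<psi>' a v t w))"
    have "?t k \<in> M 1 (B q)" if "k \<in> (SIGMA a:{1..t}. B a)" for k
    proof -
      obtain a v where k: "k = (a, v)" by (cases k)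
      then have av: "k = (a, v)" "1 \<le> a" "a \<le> t" "v \<in> B a" using that by auto
      show ?thesis
      proof (cases "q < a")
        case True
        then show ?thesis using cmD(2)[OF \<chi>, of q a v] av by (simp add: sg_simps)
      next
        case False
        have "\<psi>' a v t w \<in> K (t - (t - a))" using chain_K[OF \<psi>'[OF av(4,3)] w(1)] .
        moreover have "a \<notin> X" using ct[of a] False by (auto simp: q_def not_less) (use c1 in linarith)
        ultimately have "\<psi>' a v t w \<in> M 1 (B a)" using av by (auto simp: X_def)
        then have "mul (q - a) a (\<chi> a v q y) (\<psi>' a v t w) \<in> M (0 + 1) (B (q - a + a))"
          by (rule mul_M[OF cmD(3)[OF \<chi> y]])
        then show ?thesis using False av by (auto intro!: M_sg)
      qed
    qed
    then have S: "(\<Sum>k\<in>(SIGMA a:{1..t}. B a). ?t k) \<in> M 1 (B q)" by (rule M_sum)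
    have "f t w \<in> M 0 (B 0)" using cmD(3)[OF f w0] by simp
    have "mul q 0 y (f t w - E z) \<in> M 1 (B q)" using mul_M[OF y fw] by simp
    from M_add[OF this mul_unit_right[OF y]]
    have "mul q 0 y (f t w) - y \<in> M 1 (B q)" by (simp add: linD[OF lin_mul(2)])
    moreover have "f (q + t) (mul q t y w) - mul q 0 y (f t w) - (\<Sum>k\<in>(SIGMA a:{1..t}. B a). ?t k) \<in> M 1 (B q)"
      using co[OF y w0] by simp
    ultimately have "(mul q 0 y (f t w) - y + (\<Sum>k\<in>(SIGMA a:{1..t}. B a). ?t k))
      + (f (q + t) (mul q t y w) - mul q 0 y (f t w) - (\<Sum>k\<in>(SIGMA a:{1..t}. B a). ?t k)) \<in> M 1 (B q)"
      by (intro M_add S)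
    then show ?thesis by simp
  qed
  let ?h = "D c x"
  have h: "?h \<in> M 2 (B q)" using Dx by (simp add: q_def)
  \<comment> \<open>The difference in \<open>E_mod\<close> is linear in \<open>y\<close> and
    \<open>?h\<close> lies in \<open>m^2 F\<close>, so the error lies in \<open>m^3 F\<close>;
    \<open>soc\<close> makes it a boundary from \<open>m^2 F_c\<close>.\<close>
  have "f (q + t) (mul q t ?h w) - ?h \<in> M (2 + 1) (B q)"
    by (rule lin_M'[OF lin_diff[OF lin_comp[OF cmD(1)[OF f] lin_mul(1)] lin_id] finB E_mod h])
  then have "f (q + t) (mul q t ?h w) - ?h \<in> M 3 (B q)" by simp
  then obtain y where y: "y \<in> M 2 (B c)" "D c y = f (q + t) (mul q t ?h w) - ?h"
    using soc[of "f (q + t) (mul q t ?h w) - ?h" q] c1 by (auto simp: q_def)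
  \<comment> \<open>\<open>?h\<close> is a cycle, and the product of \<open>?h\<close> and
    \<open>D t w\<close> lies in \<open>m^4 F = 0\<close>.\<close>
  have Dmul: "D (q + t) (mul q t ?h w) = 0"
  proof -
    have "mul q (t - 1) ?h (D t w) \<in> M 4 (B (q + (t - 1)))" using mul_M[OF h Dw] by simp
    then have "mul q (t - 1) ?h (D t w) = 0" using M_4[of 4] by blast
    moreover have "D q ?h = 0" using D_D[OF x0] by (simp add: q_def)
    ultimately show ?thesis using D_mul[OF M_mono[OF _ h, of 0] w0] by (simp add: sg_simps)
  qed
  have m2: "mul q t ?h w \<in> M 2 (B (q + t))" using mul_M[OF h w0] by simp
  obtain g where g: "g \<in> M 0 (B (Suc (q + t)))" "D (Suc (q + t)) g = mul q t ?h w"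
    using resD(2)[OF res M_mono[OF _ m2, of 0] Dmul] t1 by auto
  \<comment> \<open>The degree \<open>q + 1 + t = c + t\<close> exceeds the largest exception
    \<open>t\<close>, which forces \<open>g\<close> into \<open>m F\<close>.\<close>
  have "g \<in> K (Suc (q + t))" using g m2 by (simp add: K_def)
  moreover have "Suc (q + t) \<notin> X" using ct[of "Suc (q + t)"] by auto
  ultimately have g1: "g \<in> M 1 (B (Suc (q + t)))" by (auto simp: X_def)
  have "D c (f (Suc (q + t)) g) = f (q + t) (mul q t ?h w)"
    using cmD(4)[OF f g(1)] g(2) c1 by (simp add: q_def)
  \<comment> \<open>Thus \<open>x\<close> is an element of \<open>m F_c\<close> plus a cycle; a
    cycle in positive degree is a boundary, hence also in \<open>m F_c\<close>.\<close>
  then have Dz: "D c (x - (f (Suc (q + t)) g - y)) = 0"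
    using y(2) by (simp add: linD[OF linDiff])
  have fg: "f (Suc (q + t)) g \<in> M 1 (B c)" using cm_M[OF f cxB g1] c1 by (simp add: q_def)
  then have fgy: "f (Suc (q + t)) g - y \<in> M 1 (B c)" using M_mono[OF _ y(1), of 1] by (auto intro: M_diff)
  have "x - (f (Suc (q + t)) g - y) \<in> M 0 (B c)"
    by (rule M_diff[OF x0 M_mono[OF _ fgy]]) simp
  moreover have "x - (f (Suc (q + t)) g - y) \<in> M 1 (B 0)" if "c = 0" using that c1 by simp
  ultimately have "\<exists>u \<in> M 0 (B (Suc c)). D (Suc c) u = x - (f (Suc (q + t)) g - y)"
    using Dz by (intro resD(2)[OF res])
  then obtain u where "u \<in> M 0 (B (Suc c))" "D (Suc c) u = x - (f (Suc (q + t)) g - y)" by blast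
  then have "x - (f (Suc (q + t)) g - y) \<in> M 1 (B c)" using D_M[of u 0 "Suc c"] by simp
  from M_add[OF this fgy] x(2) show False by simp
qed

text \<open>Each layer \<open>i\<close> has its own reason: \<open>K1\<close> for
  \<open>i = 0\<close>, \<open>soc\<close> for 1 and 3, \<open>m^4 = 0\<close> together with
  \<open>K1\<close> for 2, and \<open>x = 0\<close> from 4 on.\<close>

lemma linear_of_eventually_linear:
  assumes A: "\<And>n x. N < n \<Longrightarrow> x \<in> M 3 (B n) \<Longrightarrow> \<exists>y \<in> M 2 (B (Suc n)). D (Suc n) y = x"
    and K: "\<And>n. N < n \<Longrightarrow> K n \<subseteq> M 1 (B n)"
    and n: "1 \<le> n" and x: "x \<in> M i (B n)" and Dx: "D n x \<in> M (i + 2) (B (n - 1))"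
  shows "if i = 0 then x \<in> M 1 (B n)
    else \<exists>y \<in> M (i - 1) (B (Suc n)). x - D (Suc n) y \<in> M (i + 1) (B n)"
proof -
  have soc: "\<exists>y \<in> M 2 (B (Suc n)). D (Suc n) y = x" if "x \<in> M 3 (B n)" for n x
    using socle_boundary[of N, OF A that] by blast
  have K1: "K n \<subseteq> M 1 (B n)" if "1 \<le> n" for n
    using K_minimal[of N, OF soc K that] by blast
  have x0: "x \<in> M 0 (B n)" using M_mono[OF _ x] by simp
  have boundary: ?thesis if "y \<in> M (i - 1) (B (Suc n))" "D (Suc n) y = x" "i \<noteq> 0" for y
  proof -
    have "x - D (Suc n) y \<in> M (i + 1) (B n)" unfolding that(2) diff_self by (rule M_zero)
    then show ?thesis using that(1,3) by (simp only: if_False) blast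
  qed
  consider "i = 0" | "i = 1" | "i = 2" | "i = 3" | "4 \<le> i" by linarith
  then show ?thesis
  proof cases
    case 1
    then show ?thesis using K1[OF n] x0 Dx by (auto simp: K_def numeral_2_eq_2)
  next
    case 2
    then have "D n x \<in> M 3 (B (n - 1))" using Dx by (simp add: numeral_3_eq_3)
    \<comment> \<open>As \<open>y\<close> lies in \<open>m^2 F\<close>, the difference
      \<open>x - y\<close> has the same class as \<open>x\<close> in layer 1, and it is a cycle of
      the resolution itself.\<close>
    then obtain y where y: "y \<in> M 2 (B n)" "D n y = D n x" using soc[of "D n x" "n - 1"] n by auto
    have "x - y \<in> M 0 (B n)" using M_diff[OF x0 M_mono[OF _ y(1)]] by simp
    moreover have "D n (x - y) = 0" using y(2) by (simp add: linD[OF linDiff])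
    ultimately obtain y' where "y' \<in> M 0 (B (Suc n))" "D (Suc n) y' = x - y"
      using resD(2)[OF res, of "x - y" n] n by auto
    then have "y' \<in> M (i - 1) (B (Suc n))" "x - D (Suc n) y' \<in> M (i + 1) (B n)"
      using 2 y(1) by (simp_all add: numeral_2_eq_2)
    then show ?thesis using 2 by auto
  next
    case 3
    then have "D n x = 0" using M_4[OF _ Dx] by simp
    then obtain y where y: "y \<in> M 0 (B (Suc n))" "D (Suc n) y = x"
      using resD(2)[OF res x0] n by auto
    have "y \<in> K (Suc n)" using y x 3 by (simp add: K_def)
    then have "y \<in> M 1 (B (Suc n))" using K1[of "Suc n"] by auto
    then show ?thesis using 3 y(2) by (intro boundary[of y]) auto
  next
    case 4
    then obtain y where "y \<in> M 2 (B (Suc n))" "D (Suc n) y = x" using soc x by blast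
    then show ?thesis using 4 by (intro boundary[of y]) auto
  next
    case 5
    then have "x = 0" using M_4[OF _ x] by simp
    then show ?thesis using 5 by (intro boundary[OF M_zero]) (simp_all only: linD(3)[OF linDiff])
  qed
qed

end

section \<open>The product of all commutative rings on a type\<close>

text \<open>A record-based ring \<open>R\<close> need not fill its carrier type, so it is not an instance of \<^class>\<open>comm_ring\<close>.
  The product of all such rings is one, and \<open>R\<close> is the ideal of it generated by an idempotent. This makes
  type-class algebra available for \<open>R\<close>, with \<open>e\<close> playing the role of 1.\<close>

typedef ('a, 'b) cring_product =
  "{f :: ('a, 'b) ring_scheme \<Rightarrow> 'a. \<forall>R. if cring R then f R \<in> carrier R else f R = undefined}"
  morphisms coord Abs_cring_product
proof
  show "(\<lambda>R. if cring R then \<zero>\<^bsub>R\<^esub> else undefined)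
    \<in> {f :: ('a, 'b) ring_scheme \<Rightarrow> 'a. \<forall>R. if cring R then f R \<in> carrier R else f R = undefined}"
    by (auto intro: ring.ring_simprules cring.axioms)
qed

definition tuple :: "(('a, 'b) ring_scheme \<Rightarrow> 'a) \<Rightarrow> ('a, 'b) cring_product" where
  "tuple f = Abs_cring_product (\<lambda>R. if cring R then f R else undefined)"

lemma coord_tuple:
  assumes "\<And>R. cring R \<Longrightarrow> f R \<in> carrier R" "cring R"
  shows "coord (tuple f) R = f R"
  using assms by (simp add: tuple_def Abs_cring_product_inverse)

lemma coord_closed: "cring R \<Longrightarrow> coord x R \<in> carrier R"
  using coord[of x] by (auto split: if_splits)

lemma coord_eqI:
  assumes "\<And>R. cring R \<Longrightarrow> coord x R = coord y R" shows "x = y"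
proof -
  have "coord x R = coord y R" for R
    using assms[of R] coord[of x] coord[of y] by (cases "cring R") auto
  then show ?thesis by (simp add: coord_inject[symmetric] fun_eq_iff)
qed

instantiation cring_product :: (type, type) comm_ring
begin

definition "0 = tuple (\<lambda>R. \<zero>\<^bsub>R\<^esub>)"
definition "x + y = tuple (\<lambda>R. coord x R \<oplus>\<^bsub>R\<^esub> coord y R)"
definition "- x = tuple (\<lambda>R. \<ominus>\<^bsub>R\<^esub> coord x R)"
definition "x - y = tuple (\<lambda>R. coord x R \<ominus>\<^bsub>R\<^esub> coord y R)"
definition "x * y = tuple (\<lambda>R. coord x R \<otimes>\<^bsub>R\<^esub> coord y R)"

lemma coord_simps:
  assumes "cring R"
  shows "coord 0 R = \<zero>\<^bsub>R\<^esub>" "coord (x + y) R = coord x R \<oplus>\<^bsub>R\<^esub> coord y R"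
    "coord (- x) R = \<ominus>\<^bsub>R\<^esub> coord x R" "coord (x - y) R = coord x R \<ominus>\<^bsub>R\<^esub> coord y R"
    "coord (x * y) R = coord x R \<otimes>\<^bsub>R\<^esub> coord y R"
  unfolding zero_cring_product_def plus_cring_product_def uminus_cring_product_def
    minus_cring_product_def times_cring_product_def
  by (intro coord_tuple assms;
      auto simp: coord_closed intro!: cring.cring_simprules abelian_group.minus_closed ring.is_abelian_group cring.axioms)+

instance
proof
  fix x y z :: "('a, 'b) cring_product"
  show "x * y * z = x * (y * z)"
    by (rule coord_eqI) (simp add: coord_simps coord_closed cring.cring_simprules)
  show "x * y = y * x"
    by (rule coord_eqI) (simp add: coord_simps coord_closed cring.cring_simprules(14))
  show "x + y + z = x + (y + z)"
    by (rule coord_eqI) (simp add: coord_simps coord_closed cring.cring_simprules)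
  show "x + y = y + x"
    by (rule coord_eqI) (simp add: coord_simps coord_closed cring.cring_simprules(10))
  show "0 + x = x"
    by (rule coord_eqI) (simp add: coord_simps coord_closed cring.cring_simprules)
  show "- x + x = 0"
    by (rule coord_eqI) (simp add: coord_simps coord_closed cring.cring_simprules)
  show "x - y = x + - y"
    by (rule coord_eqI) (simp add: coord_simps a_minus_def)
  show "(x + y) * z = x * z + y * z"
    by (rule coord_eqI) (simp add: coord_simps coord_closed cring.cring_simprules)
qed

end

definition emb :: "('a, 'b) ring_scheme \<Rightarrow> 'a \<Rightarrow> ('a, 'b) cring_product" where
  "emb R r = tuple (\<lambda>S. if S = R then r else \<zero>\<^bsub>S\<^esub>)"

context cring
begin

lemma coord_emb: "r \<in> carrier R \<Longrightarrow> cring S \<Longrightarrow> coord (emb R r) S = (if S = R then r else \<zero>\<^bsub>S\<^esub>)"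
  unfolding emb_def by (intro coord_tuple) (auto simp: cring.cring_simprules)

lemma emb_zero: "emb R \<zero> = 0"
  by (rule coord_eqI) (auto simp: coord_emb coord_simps)

lemma emb_add: "r \<in> carrier R \<Longrightarrow> s \<in> carrier R \<Longrightarrow> emb R (r \<oplus> s) = emb R r + emb R s"
  by (rule coord_eqI) (auto simp: coord_emb coord_simps cring.cring_simprules)

text \<open>This makes the image of \<open>emb R\<close> an ideal of the product ring: an arbitrary
  scalar acts through its coordinate at \<open>R\<close>.\<close>

lemma emb_mult_left: "r \<in> carrier R \<Longrightarrow> x * emb R r = emb R (coord x R \<otimes> r)"
  by (rule coord_eqI) (auto simp: coord_emb coord_simps coord_closed is_cring cring.cring_simprules)

lemma coord_emb_self: "r \<in> carrier R \<Longrightarrow> coord (emb R r) R = r"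
  by (simp add: coord_emb is_cring)

lemma emb_mult: "r \<in> carrier R \<Longrightarrow> s \<in> carrier R \<Longrightarrow> emb R (r \<otimes> s) = emb R r * emb R s"
  by (simp add: emb_mult_left coord_emb_self)

lemma emb_eq_iff: "r \<in> carrier R \<Longrightarrow> s \<in> carrier R \<Longrightarrow> emb R r = emb R s \<longleftrightarrow> r = s"
  using coord_emb_self by metis

lemma emb_finsum:
  assumes "finite A" "f \<in> A \<rightarrow> carrier R"
  shows "emb R (finsum R f A) = (\<Sum>a\<in>A. emb R (f a))"
  using assms by (induction A) (auto simp: emb_zero emb_add Pi_iff intro!: finsum_closed)

section \<open>Powers of an ideal and inverses modulo a maximal ideal\<close>

lemma ideal_pow_ideal:
  assumes "ideal m R" shows "ideal (ideal_pow R m k) R"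
  by (induction k) (auto simp: oneideal ideal_prod_is_ideal assms)

lemma ideal_pow_mult:
  assumes m: "ideal m R" and x: "x \<in> ideal_pow R m k" and y: "y \<in> ideal_pow R m l"
  shows "x \<otimes> y \<in> ideal_pow R m (k + l)"
  using x
proof (induction k arbitrary: x)
  case 0
  then show ?case using ideal.I_l_closed[OF ideal_pow_ideal[OF m] y] by simp
next
  case (Suc k)
  have yc: "y \<in> carrier R" using ideal.Icarr[OF ideal_pow_ideal[OF m] y] .
  have "x \<in> ideal_prod R m (ideal_pow R m k)" using Suc.prems by simp
  then show ?case
  proof induction
    case (prod i j)
    have "i \<in> carrier R" "j \<in> carrier R"
      using prod ideal.Icarr[OF m] ideal.Icarr[OF ideal_pow_ideal[OF m]] by blast+
    then show ?case
      using prod Suc.IH[OF prod(2)] yc by (auto simp: m_assoc intro: ideal_prod.prod)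
  next
    case (sum s t)
    have "s \<in> carrier R" "t \<in> carrier R"
      using sum ideal_prod_in_carrier[OF m ideal_pow_ideal[OF m]] by blast+
    then show ?case
      using sum yc by (auto simp: l_distr intro: ideal_prod.sum)
  qed
qed

lemma ideal_pow_1:
  assumes "ideal m R" shows "ideal_pow R m 1 = m"
  using ideal_prod_one[OF assms] by simp

lemma ideal_pow_Suc_subset:
  assumes "ideal m R" shows "ideal_pow R m (Suc k) \<subseteq> ideal_pow R m k"
  using ideal_prod_inter[OF assms ideal_pow_ideal[OF assms]] by auto

text \<open>The ideal \<open>m + (r)\<close> is strictly larger than \<open>m\<close>, hence
  contains 1.\<close>

lemma maximalideal_inverse:
  assumes m: "maximalideal m R" and r: "r \<in> carrier R" "r \<notin> m"
  shows "\<exists>s \<in> carrier R. s \<otimes> r \<ominus> \<one> \<in> m"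
proof -
  have mi: "ideal m R" using m by (rule maximalideal.axioms)
  let ?J = "set_add R m (PIdl r)"
  have J: "ideal ?J R" by (rule add_ideals[OF mi cgenideal_ideal[OF r(1)]])
  have P: "PIdl r = {x \<otimes> r |x. x \<in> carrier R}" by (simp add: cgenideal_def)
  have "m \<subseteq> ?J"
  proof
    fix a assume a: "a \<in> m"
    have "a = a \<oplus> \<zero> \<otimes> r" using ideal.Icarr[OF mi a] r by simp
    then show "a \<in> ?J" using a unfolding set_add_def' P by blast
  qed
  moreover have "r \<in> ?J"
  proof -
    have "r = \<zero> \<oplus> \<one> \<otimes> r" using r by simp
    then show ?thesis
      using additive_subgroup.zero_closed[OF ideal.axioms(1)[OF mi]] unfolding set_add_def' P by blast
  qed
  ultimately have "?J = carrier R"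
    using maximalideal.I_maximal[OF m J] ideal.Icarr[OF J] r(2) by blast
  then have "\<one> \<in> ?J" by simp
  then obtain a s where as: "a \<in> m" "s \<in> carrier R" "\<one> = a \<oplus> s \<otimes> r"
    unfolding set_add_def' P by blast
  have ac: "a \<in> carrier R" using ideal.Icarr[OF mi as(1)] .
  have "s \<otimes> r \<ominus> \<one> = \<ominus> a"
    using ac as(2) r(1) unfolding as(3) by algebra
  then show ?thesis
    using as(2) additive_subgroup.a_inv_closed[OF ideal.axioms(1)[OF mi] as(1)] by (intro bexI[of _ s]) auto
qed

end

section \<open>The residue field\<close>

locale residue_resolution = cring R
  for R :: "('a, 'b) ring_scheme" (structure) +
  fixes m :: "'a set" and b :: "nat \<Rightarrow> nat" and d :: "nat \<Rightarrow> nat \<Rightarrow> nat \<Rightarrow> 'a"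
  assumes max: "maximalideal m R" and m4: "ideal_pow R m 4 = {\<zero>}"
    and res: "min_free_res_residue R m b d"
begin

lemma m_ideal: "ideal m R"
  using max by (rule maximalideal.axioms)

lemmas pow_ideal = ideal_pow_ideal[OF m_ideal]
lemmas pow_carrier = ideal.Icarr[OF pow_ideal]
lemmas pow_1 = ideal_pow_1[OF m_ideal]

lemma pow_zero: "\<zero> \<in> ideal_pow R m k"
  using additive_subgroup.zero_closed[OF ideal.axioms(1)[OF pow_ideal]] .

definition I :: "nat \<Rightarrow> ('a, 'b) cring_product set" where
  "I k = emb R ` ideal_pow R m k"

lemma emb_in_I: "r \<in> carrier R \<Longrightarrow> emb R r \<in> I k \<longleftrightarrow> r \<in> ideal_pow R m k"
  unfolding I_def using emb_eq_iff pow_carrier by blast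

sublocale F: filtered_ring "emb R \<one>" I
proof
  show "I 0 = {r. emb R \<one> * r = r}"
  proof (intro equalityI subsetI)
    fix x assume "x \<in> I 0"
    then show "x \<in> {r. emb R \<one> * r = r}" by (auto simp: I_def emb_mult[symmetric])
  next
    fix x assume "x \<in> {r. emb R \<one> * r = r}"
    then have "x = emb R (coord x R)"
      using emb_mult_left[OF one_closed, of x] coord_closed[OF is_cring, of x] by (simp add: mult.commute)
    then show "x \<in> I 0" unfolding I_def using coord_closed[OF is_cring, of x] by auto
  qed
  show "0 \<in> I k" for k
    using emb_in_I[OF zero_closed] pow_zero by (simp add: emb_zero)
  show "x + y \<in> I k" if "x \<in> I k" "y \<in> I k" for x y k
  proof -
    from that obtain r s where rs: "x = emb R r" "y = emb R s" "r \<in> ideal_pow R m k" "s \<in> ideal_pow R m k"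
      by (auto simp: I_def)
    then have "x + y = emb R (r \<oplus> s)" using emb_add pow_carrier by auto
    then show ?thesis
      using additive_subgroup.a_closed[OF ideal.axioms(1)[OF pow_ideal] rs(3,4)] by (simp add: I_def)
  qed
  show "r * y \<in> I k" if "y \<in> I k" for r y k
  proof -
    from that obtain s where s: "y = emb R s" "s \<in> ideal_pow R m k" by (auto simp: I_def)
    then have "r * y = emb R (coord r R \<otimes> s)" using emb_mult_left pow_carrier by auto
    then show ?thesis
      using ideal.I_l_closed[OF pow_ideal s(2) coord_closed[OF is_cring]] by (simp add: I_def)
  qed
  show "I (Suc k) \<subseteq> I k" for k
    unfolding I_def using ideal_pow_Suc_subset[OF m_ideal] by blast
  show "x * y \<in> I (k + l)" if "x \<in> I k" "y \<in> I l" for x y k l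
  proof -
    from that obtain r s where rs: "x = emb R r" "y = emb R s" "r \<in> ideal_pow R m k" "s \<in> ideal_pow R m l"
      by (auto simp: I_def)
    then have "x * y = emb R (r \<otimes> s)" using emb_mult pow_carrier by auto
    then show ?thesis using ideal_pow_mult[OF m_ideal rs(3,4)] by (auto simp: I_def)
  qed
  show "I 4 = {0}" by (simp add: I_def m4 emb_zero)
  show "emb R \<one> * emb R \<one> = emb R \<one>" by (simp add: emb_mult[symmetric])
  show "\<exists>s. s * r - emb R \<one> \<in> I 1" if "r \<in> I 0" "r \<notin> I 1" for r
  proof -
    from that obtain x where x: "r = emb R x" "x \<in> carrier R" by (auto simp: I_def)
    then have "x \<notin> m" using that emb_in_I[of x 1] by (simp add: pow_1 del: One_nat_def)
    then obtain s where s: "s \<in> carrier R" "s \<otimes> x \<ominus> \<one> \<in> m"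
      using maximalideal_inverse[OF max x(2)] by blast
    have "emb R (s \<otimes> x \<ominus> \<one>) + emb R \<one> = emb R (s \<otimes> x \<ominus> \<one> \<oplus> \<one>)"
      using s x by (intro emb_add[symmetric]) auto
    also have "s \<otimes> x \<ominus> \<one> \<oplus> \<one> = s \<otimes> x" using s x by algebra
    finally have "emb R s * r - emb R \<one> = emb R (s \<otimes> x \<ominus> \<one>)"
      using s x by (simp add: emb_mult algebra_simps)
    then show ?thesis using s(2) x s(1) emb_in_I[of "s \<otimes> x \<ominus> \<one>" 1] pow_1 by (metis imageI I_def)
  qed
qed

section \<open>Transport of the given resolution to the product ring\<close>

definition embv :: "(nat \<Rightarrow> 'a) \<Rightarrow> nat \<Rightarrow> ('a, 'b) cring_product" where
  "embv x = (\<lambda>j. emb R (x j))"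

lemma fvecs_carrier: "x \<in> fvecs R n \<Longrightarrow> x j \<in> carrier R"
  by (cases "j < n") (auto simp: fvecs_def)

lemma embv_M: "x \<in> fvecs R (b n) \<Longrightarrow> embv x \<in> F.M k {..<b n} \<longleftrightarrow> x \<in> mF R m b k n"
  using fvecs_carrier[of x "b n"] pow_zero
  by (auto simp: F.M_def embv_def mF_def emb_in_I emb_zero fvecs_def)
     (metis not_le_imp_less)

lemma embv_surj:
  assumes "X \<in> F.M k {..<b n}"
  obtains x where "x \<in> mF R m b k n" "X = embv x"
proof -
  have "\<exists>r. r \<in> ideal_pow R m k \<and> X j = emb R r" for j
    using assms by (auto simp: F.M_def I_def)
  then obtain x where x: "\<And>j. x j \<in> ideal_pow R m k" "\<And>j. X j = emb R (x j)" by metis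
  have X: "X = embv x" using x(2) by (auto simp: embv_def)
  have "x j = \<zero>" if "b n \<le> j" for j
  proof -
    have "emb R (x j) = emb R \<zero>" using assms that x(2)[of j] by (auto simp: F.M_def emb_zero)
    then show ?thesis using emb_eq_iff[of "x j" \<zero>] pow_carrier[OF x(1)] by simp
  qed
  then have "x \<in> mF R m b k n" using x(1) pow_carrier by (auto simp: mF_def fvecs_def)
  then show thesis using X that by blast
qed

lemma embv_inj: "x \<in> fvecs R p \<Longrightarrow> y \<in> fvecs R q \<Longrightarrow> embv x = embv y \<Longrightarrow> x = y"
  using fvecs_carrier emb_eq_iff unfolding embv_def fun_eq_iff by metis

lemma embv_vadd: "x \<in> fvecs R p \<Longrightarrow> y \<in> fvecs R q \<Longrightarrow> embv (vadd R x y) = embv x + embv y"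
  using fvecs_carrier by (auto simp: embv_def vadd_def emb_add fun_eq_iff)

lemma embv_vzero: "embv (vzero R) = 0"
  by (auto simp: embv_def vzero_def emb_zero fun_eq_iff)

lemma vzero_mF: "vzero R \<in> mF R m b k n"
  using pow_zero by (auto simp: mF_def vzero_def fvecs_def)

lemma mF_fvecs: "x \<in> mF R m b k n \<Longrightarrow> x \<in> fvecs R (b n)"
  by (simp add: mF_def)

lemma d_in_m: "1 \<le> n \<Longrightarrow> j < b (n - 1) \<Longrightarrow> k < b n \<Longrightarrow> d n j k \<in> m"
  using res by (simp add: min_free_res_residue_def)

lemma d_carrier: "1 \<le> n \<Longrightarrow> j < b (n - 1) \<Longrightarrow> k < b n \<Longrightarrow> d n j k \<in> carrier R"
  using ideal.Icarr[OF m_ideal d_in_m] .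

text \<open>In degree 0 \<open>dmap\<close> would read the matrix \<open>d 0\<close>, which does not
  belong to the resolution; the zero map takes its place.\<close>

definition D :: "nat \<Rightarrow> (nat \<Rightarrow> ('a, 'b) cring_product) \<Rightarrow> nat \<Rightarrow> ('a, 'b) cring_product" where
  "D n = (if n = 0 then 0
    else F.ext {..<b n} (\<lambda>k j. if j < b (n - 1) then emb R (d n j k) else 0))"

lemma lin_D: "lin (D n)"
  by (simp add: D_def F.lin_ext lin_zero)

lemma dmap_fvecs:
  assumes "1 \<le> n" "x \<in> fvecs R (b n)" shows "dmap R b d n x \<in> fvecs R (b (n - 1))"
  using assms d_carrier fvecs_carrier[OF assms(2)]
  by (auto simp: fvecs_def dmap_def intro!: finsum_closed)

lemma D_embv:
  assumes n: "1 \<le> n" and x: "x \<in> fvecs R (b n)"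
  shows "D n (embv x) = embv (dmap R b d n x)"
proof
  fix j
  show "D n (embv x) j = embv (dmap R b d n x) j"
  proof (cases "j < b (n - 1)")
    case True
    have "embv (dmap R b d n x) j = (\<Sum>k<b n. emb R (d n j k \<otimes> x k))"
      using True n d_carrier fvecs_carrier[OF x]
      by (simp add: embv_def dmap_def) (intro emb_finsum; auto)
    also have "\<dots> = D n (embv x) j"
      using True n d_carrier fvecs_carrier[OF x]
      by (auto simp: D_def F.ext_def sum_fun_apply vscale_def embv_def emb_mult mult.commute intro!: sum.cong)
    finally show ?thesis by simp
  next
    case False
    then show ?thesis using n
      by (auto simp: D_def F.ext_def sum_fun_apply vscale_def embv_def dmap_def emb_zero)
  qed
qed

lemma D_M1: "X \<in> F.M k {..<b n} \<Longrightarrow> D n X \<in> F.M (Suc k) {..<b (n - 1)}"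
proof (cases "n = 0")
  case False
  assume X: "X \<in> F.M k {..<b n}"
  have "(\<lambda>j. if j < b (n - 1) then emb R (d n j i) else 0) \<in> F.M 1 {..<b (n - 1)}" if "i < b n" for i
    using d_in_m[of n _ i] d_carrier[of n _ i] False that F.I_zero
    by (auto simp: F.M_def emb_in_I pow_1 simp del: One_nat_def ideal_pow.simps)
  then have "F.ext {..<b n} (\<lambda>k j. if j < b (n - 1) then emb R (d n j k) else 0) X \<in> F.M (k + 1) {..<b (n - 1)}"
    using X by (intro F.ext_M) auto
  then show ?thesis using False by (simp add: D_def)
qed (simp add: D_def)

lemma D_zero_iff:
  assumes "1 \<le> n" "x \<in> fvecs R (b n)"
  shows "D n (embv x) = 0 \<longleftrightarrow> dmap R b d n x = vzero R"
  using embv_inj[OF dmap_fvecs[OF assms], of "vzero R" "b n"] vzero_mF[of 0 n]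
  by (auto simp: D_embv[OF assms] embv_vzero mF_fvecs)

sublocale G: resolution "emb R \<one>" I "\<lambda>n. {..<b n}" D 0
proof
  have ker: "{x \<in> fvecs R (b n). dmap R b d n x = vzero R} = dmap R b d (Suc n) ` fvecs R (b (Suc n))"
    if "1 \<le> n" for n
    using res that by (simp add: min_free_res_residue_def)
  have im: "dmap R b d 1 ` fvecs R (b 1) = {x \<in> fvecs R 1. x 0 \<in> m}" and b0: "b 0 = 1"
    using res by (simp_all add: min_free_res_residue_def)
  show "{..<b 0} = {0}" by (auto simp: b0)
  show "F.res (\<lambda>n. {..<b n}) D"
    unfolding F.res_def F.cx_def
  proof (intro conjI allI impI)
    show "finite {..<b n}" "lin (D n)" for n by (simp_all add: lin_D)
    show "D 0 = 0" by (simp add: D_def)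
    fix n and X :: "nat \<Rightarrow> ('a, 'b) cring_product" assume X: "X \<in> F.M 0 {..<b n}"
    then obtain x where x: "x \<in> fvecs R (b n)" "X = embv x" using embv_surj mF_fvecs by metis
    show "D n X \<in> F.M 1 {..<b (n - 1)}" using D_M1[OF X] by simp
    show "D (n - 1) (D n X) = 0"
    proof (cases "n \<le> 1")
      case True
      then show ?thesis by (cases n) (auto simp: D_def)
    next
      case False
      then have "dmap R b d n x \<in> {x \<in> fvecs R (b (n - 1)). dmap R b d (n - 1) x = vzero R}"
        using ker[of "n - 1"] x(1) by auto
      then show ?thesis using D_zero_iff[of "n - 1" "dmap R b d n x"] D_embv[of n x] x False by simp
    qed
    assume DX: "D n X = 0" and X1: "n = 0 \<longrightarrow> X \<in> F.M 1 {..<b 0}"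
    have "x \<in> dmap R b d (Suc n) ` fvecs R (b (Suc n))"
    proof (cases "n = 0")
      case True
      then have "x \<in> mF R m b 1 0" using X1 x embv_M[of x 0 1] by simp
      then have "x \<in> {x \<in> fvecs R 1. x 0 \<in> m}"
        by (simp add: mF_def b0 pow_1 del: One_nat_def ideal_pow.simps)
      then show ?thesis using im True by simp
    next
      case False
      then have "dmap R b d n x = vzero R" using D_zero_iff[of n x] DX x by simp
      then show ?thesis using ker[of n] False x(1) by auto
    qed
    then obtain y where y: "y \<in> fvecs R (b (Suc n))" "x = dmap R b d (Suc n) y" by blast
    then have "y \<in> mF R m b 0 (Suc n)" by (auto simp: mF_def fvecs_def)
    then have "embv y \<in> F.M 0 {..<b (Suc n)}" using embv_M[OF y(1)] by simp
    moreover have "D (Suc n) (embv y) = X" using D_embv[OF _ y(1)] y(2) x(2) by simp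
    ultimately show "\<exists>y \<in> F.M 0 {..<b (Suc n)}. D (Suc n) y = X" by blast
  qed
qed

lemma lin_cycles_iff:
  assumes n: "1 \<le> n"
  shows "x \<in> lin_cycles R m b d n i \<longleftrightarrow>
    x \<in> fvecs R (b n) \<and> embv x \<in> F.M i {..<b n} \<and> D n (embv x) \<in> F.M (i + 2) {..<b (n - 1)}"
  using n embv_M[of x n i] embv_M[OF dmap_fvecs[OF n], of x "i + 2"] D_embv[OF n, of x]
  by (auto simp: lin_cycles_def mF_fvecs)

lemma lin_boundaries_iff:
  assumes x: "x \<in> fvecs R (b n)"
  shows "x \<in> lin_boundaries R m b d n i \<longleftrightarrow> (if i = 0 then embv x \<in> F.M 1 {..<b n}
    else \<exists>y \<in> F.M (i - 1) {..<b (Suc n)}. embv x - D (Suc n) y \<in> F.M (i + 1) {..<b n})"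
proof (cases "i = 0")
  case True
  then show ?thesis using embv_M[OF x, of 1] by (simp add: lin_boundaries_def)
next
  case False
  have "(\<exists>y z. x = vadd R (dmap R b d (Suc n) y) z \<and> y \<in> mF R m b (i - 1) (Suc n) \<and> z \<in> mF R m b (i + 1) n)
    \<longleftrightarrow> (\<exists>y \<in> F.M (i - 1) {..<b (Suc n)}. embv x - D (Suc n) y \<in> F.M (i + 1) {..<b n})" (is "?L \<longleftrightarrow> ?R")
  proof
    assume ?L
    then obtain y z where yz: "x = vadd R (dmap R b d (Suc n) y) z"
      "y \<in> mF R m b (i - 1) (Suc n)" "z \<in> mF R m b (i + 1) n" by blast
    have y: "y \<in> fvecs R (b (Suc n))" and z: "z \<in> fvecs R (b n)" using yz mF_fvecs by blast+
    have "embv x - D (Suc n) (embv y) = embv z"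
      using embv_vadd[OF dmap_fvecs[OF _ y] z] D_embv[OF _ y] yz(1) by simp
    then show ?R using embv_M[OF y, of "i - 1"] embv_M[OF z, of "i + 1"] yz by (metis)
  next
    assume ?R
    then obtain Y where Y: "Y \<in> F.M (i - 1) {..<b (Suc n)}" "embv x - D (Suc n) Y \<in> F.M (i + 1) {..<b n}" by blast
    obtain y where y: "y \<in> mF R m b (i - 1) (Suc n)" "Y = embv y" using embv_surj[OF Y(1)] .
    obtain z where z: "z \<in> mF R m b (i + 1) n" "embv x - D (Suc n) Y = embv z" using embv_surj[OF Y(2)] .
    note yf = mF_fvecs[OF y(1)] and zf = mF_fvecs[OF z(1)]
    have df: "dmap R b d (Suc n) y \<in> fvecs R (b n)" using dmap_fvecs[OF _ yf] by simp
    have "embv (vadd R (dmap R b d (Suc n) y) z) = D (Suc n) Y + (embv x - D (Suc n) Y)"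
      using embv_vadd[OF df zf] D_embv[OF _ yf] y(2) z(2) by simp
    also have "\<dots> = embv x" by simp
    finally have "embv x = embv (vadd R (dmap R b d (Suc n) y) z)" by simp
    moreover have "vadd R (dmap R b d (Suc n) y) z \<in> fvecs R (b n)"
      using df zf by (auto simp: fvecs_def vadd_def)
    ultimately have "x = vadd R (dmap R b d (Suc n) y) z" using embv_inj[OF x] by blast
    then show ?L using y(1) z(1) by blast
  qed
  then show ?thesis using False by (auto simp: lin_boundaries_def)
qed

lemma lin_homology_zero:
  assumes N: "\<And>n. N < n \<Longrightarrow> \<not> lin_homology_nonzero R m b d n" and n: "1 \<le> n"
  shows "\<not> lin_homology_nonzero R m b d n"
proof -
  have big: "if i = 0 then X \<in> F.M 1 {..<b n}
    else \<exists>y \<in> F.M (i - 1) {..<b (Suc n)}. X - D (Suc n) y \<in> F.M (i + 1) {..<b n}"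
    if n: "N < n" and X: "X \<in> F.M i {..<b n}" and DX: "D n X \<in> F.M (i + 2) {..<b (n - 1)}" for n i X
  proof -
    obtain x where x: "x \<in> mF R m b i n" "X = embv x" using embv_surj[OF X] .
    have xf: "x \<in> fvecs R (b n)" using mF_fvecs[OF x(1)] .
    have "x \<in> lin_cycles R m b d n i" using lin_cycles_iff[of n x i] xf X DX x(2) n by simp
    then have "x \<in> lin_boundaries R m b d n i" using N[OF n] by (auto simp: lin_homology_nonzero_def)
    then show ?thesis by (simp only: lin_boundaries_iff[OF xf] x(2))
  qed
  \<comment> \<open>Layer \<open>i = 3\<close>: the error term of a linear boundary lies in
    \<open>m^4 F = 0\<close>, so \<open>X\<close> is an actual boundary.\<close>
  have A: "\<exists>y \<in> F.M 2 {..<b (Suc n)}. D (Suc n) y = X" if n: "N < n" and X: "X \<in> F.M 3 {..<b n}" for n X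
  proof -
    have "D n X = 0" using F.M_4[OF _ D_M1[OF X]] by simp
    then obtain y where "y \<in> F.M 2 {..<b (Suc n)}" "X - D (Suc n) y \<in> F.M 4 {..<b n}"
      using big[OF n X] by auto
    then show ?thesis using F.M_4[of 4 "X - D (Suc n) y"] by auto
  qed
  have K: "G.K n \<subseteq> F.M 1 {..<b n}" if n: "N < n" for n
    using big[OF n, of _ 0] by (auto simp: G.K_def numeral_2_eq_2)
  show ?thesis
    unfolding lin_homology_nonzero_def not_ex not_not
  proof (intro allI subsetI)
    fix i x assume "x \<in> lin_cycles R m b d n i"
    then have x: "x \<in> fvecs R (b n)" "embv x \<in> F.M i {..<b n}" "D n (embv x) \<in> F.M (i + 2) {..<b (n - 1)}"
      using lin_cycles_iff[OF n] by auto
    show "x \<in> lin_boundaries R m b d n i"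
      unfolding lin_boundaries_iff[OF x(1)]
      by (rule G.linear_of_eventually_linear[OF A K n x(2,3)])
  qed
qed

text \<open>The class of 1 in \<open>F_0 / m F_0\<close> survives, since in layer 0 only
  \<open>m F_0\<close> counts as boundaries. This keeps the supremum from being
  \<open>-\<infinity>\<close>.\<close>

lemma lin_homology_0: "lin_homology_nonzero R m b d 0"
proof -
  have b0: "b 0 = 1" using res by (simp add: min_free_res_residue_def)
  let ?u = "\<lambda>j::nat. if j = 0 then \<one> else \<zero>"
  have "\<one> \<notin> m"
    using ideal.one_imp_carrier[OF m_ideal] maximalideal.I_notcarr[OF max] by auto
  then have "?u \<notin> lin_boundaries R m b d 0 0"
    by (auto simp: lin_boundaries_def mF_def b0 pow_1 simp del: ideal_pow.simps One_nat_def)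
  moreover have "?u \<in> lin_cycles R m b d 0 0"
    by (auto simp: lin_cycles_def mF_def b0 fvecs_def)
  ultimately show ?thesis unfolding lin_homology_nonzero_def by blast
qed

end

theorem theorem2p7:
  fixes R :: "('a, 'b) ring_scheme" and m :: "'a set"
    and b :: "nat \<Rightarrow> nat" and d :: "nat \<Rightarrow> nat \<Rightarrow> nat \<Rightarrow> 'a"
  assumes "noeth_local_ring R m"
    and "artinian_ring R"
    and "ideal_pow R m 4 = {\<zero>\<^bsub>R\<^esub>}"
    and "min_free_res_residue R m b d"
    and "lin_defect R m b d < \<infinity>"
  shows "lin_defect R m b d = 0"
proof -
  interpret residue_resolution R m b d
    using assms(1,3,4)
    by (simp add: residue_resolution_def residue_resolution_axioms_def noeth_local_ring_def)
  obtain N :: nat where N: "lin_defect R m b d < ereal (real N)"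
    using assms(5) less_PInf_Ex_of_nat[of "lin_defect R m b d"] by auto
  have "n \<le> N" if "lin_homology_nonzero R m b d n" for n
  proof -
    have "ereal (real n) \<le> lin_defect R m b d"
      unfolding lin_defect_def using that by (auto intro: Sup_upper)
    then have "ereal (real n) < ereal (real N)" using N by (rule le_less_trans)
    then show ?thesis by simp
  qed
  then have "\<not> lin_homology_nonzero R m b d n" if "1 \<le> n" for n
    using lin_homology_zero[of N n] that by force
  then have "{ereal (real n) |n. lin_homology_nonzero R m b d n} = {0}"
    using lin_homology_0 by (auto simp: zero_ereal_def) (metis One_nat_def less_one not_le)+
  then show ?thesis by (simp add: lin_defect_def)
qed

end
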